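(* Let $\Gamma \subseteq \mathbb{R}^d$ be an acute, convex, solid cone with dual cone $\Gamma^\ast = \{ \eta \in \mathbb{R}^d: \eta \cdot x \geq 0 \text{ for all } x \in \Gamma \}$, and let $\mu$ be an admissible measure supported by $\Gamma^\ast$. There exists an admissible measure supported on $\Gamma^\ast$, different from $\mu$ and moment equivalent to $\mu$, if and only if there exists $a \in \operatorname{int}\Gamma$ such that $$ \sup_{p(x) \leq \frac{1}{a\cdot x+1}\ \forall x \in \Gamma^\ast} \int p \, d\mu \;<\; \inf_{q(x) \geq \frac{1}{a\cdot x+1}\ \forall x \in \Gamma^\ast} \int q\, d\mu ,$$ where $p,q$ range over real polynomials. Moreover, when this holds, the set of $a\in\operatorname{int}\Gamma$ for which the strict inequality holds is an open, everywhere dense subset of $\operatorname{int}\Gamma$.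
   Context: An admissible measure on a closed set $X \subseteq \mathbb{R}^d$ is a positive Radon measure $\mu$ supported on $X$ such that $\int_X |p|\,d\mu<\infty$ for every polynomial $p$. Two admissible measures are moment equivalent if they give the same integral to every polynomial. A cone is acute if its closure contains no line, and solid if it has nonempty interior. *)

theory Defs
  imports "HOL-Analysis.Analysis" "HOL-Probability.Probability"
begin

inductive_set polyfun :: "('a::euclidean_space \<Rightarrow> real) set" where
  const: "(\<lambda>x. c) \<in> polyfun"
| coord: "b \<in> Basis \<Longrightarrow> (\<lambda>x. x \<bullet> b) \<in> polyfun"
| add: "p \<in> polyfun \<Longrightarrow> q \<in> polyfun \<Longrightarrow> (\<lambda>x. p x + q x) \<in> polyfun"
| mult: "p \<in> polyfun \<Longrightarrow> q \<in> polyfun \<Longrightarrow> (\<lambda>x. p x * q x) \<in> polyfun"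

text \<open>Admissible measure on a closed set X: a (positive) Borel measure supported
on X for which every polynomial is integrable (this forces finiteness, hence
the measure is Radon).\<close>
definition admissible :: "'a::euclidean_space set \<Rightarrow> 'a measure \<Rightarrow> bool" where
  "admissible X M \<longleftrightarrow> sets M = sets borel \<and> emeasure M (UNIV - X) = 0 \<and>
     (\<forall>p\<in>polyfun. integrable M p)"

definition moment_equivalent :: "'a::euclidean_space measure \<Rightarrow> 'a measure \<Rightarrow> bool" where
  "moment_equivalent M N \<longleftrightarrow> (\<forall>p\<in>polyfun. integral\<^sup>L M p = integral\<^sup>L N p)"

definition acute_cone :: "'a::euclidean_space set \<Rightarrow> bool" where
  "acute_cone G \<longleftrightarrow> cone G \<and> \<not> (\<exists>x v. v \<noteq> 0 \<and> (\<forall>t::real. x + t *\<^sub>R v \<in> closure G))"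

definition solid :: "'a::euclidean_space set \<Rightarrow> bool" where
  "solid G \<longleftrightarrow> interior G \<noteq> {}"

definition dual_cone :: "'a::euclidean_space set \<Rightarrow> 'a set" where
  "dual_cone G = {\<eta>. \<forall>x\<in>G. \<eta> \<bullet> x \<ge> 0}"

definition lower_val :: "'a::euclidean_space set \<Rightarrow> 'a measure \<Rightarrow> 'a \<Rightarrow> real" where
  "lower_val X M a = Sup ((\<lambda>p. integral\<^sup>L M p) `
      {p\<in>polyfun. \<forall>x\<in>X. p x \<le> 1 / (a \<bullet> x + 1)})"

definition upper_val :: "'a::euclidean_space set \<Rightarrow> 'a measure \<Rightarrow> 'a \<Rightarrow> real" where
  "upper_val X M a = Inf ((\<lambda>q. integral\<^sup>L M q) `
      {q\<in>polyfun. \<forall>x\<in>X. q x \<ge> 1 / (a \<bullet> x + 1)})"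

end

theory Submission
  imports Defs
begin

text \<open>
  Let \<open>X\<close> be the dual cone of \<open>\<Gamma>\<close> and \<open>k\<^sub>a(x) = 1 / (a \<bullet> x + 1)\<close>.

  If the lower and upper values at \<open>a\<close> differ, Hahn--Banach extends integration of polynomials to
  positive functionals, on all functions on \<open>X\<close> of polynomial growth, that take either of these two
  values at \<open>k\<^sub>a\<close>. Each functional is represented by a measure on its continuous functions
  (tightness comes from the second moment), and one of the two measures is not \<open>\<mu>\<close>.

  Conversely, integrals of \<open>k\<^sub>a\<close> for \<open>a\<close> in an arbitrarily small ball of \<open>int \<Gamma>\<close> determine a finite
  measure on \<open>X\<close>: rescaling \<open>a\<close> gives the Stieltjes transform of the image under \<open>x \<mapsto> a \<bullet> x\<close>
  near one point, hence that image, hence the Laplace transform on the open cone over the ball,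
  and the exponentials \<open>exp (- (a \<bullet> x))\<close> span an algebra to which Stone--Weierstrass applies. So a
  second moment equivalent measure separates the values at some \<open>a\<close> in every such ball, which
  also gives density. Openness holds because both values are Lipschitz in \<open>a\<close>.
\<close>


subsection \<open>Polynomial functions\<close>

text \<open>Noncompactness of \<open>X\<close> is the obstacle in both directions. A positive
  functional could lose mass at infinity; since polynomials lie in its domain,
  \<open>L (\<lambda>x. x \<bullet> x)\<close> is a finite number that bounds what sits outside a
  large ball, and in the same way \<open>L (\<lambda>x. f x * f x)\<close> bounds the error of
  truncating an unbounded \<open>f\<close>. The domain contains discontinuous functions too, so that
  \<open>L\<close> can be evaluated on indicators of closed sets and compared there with a measure.
  In the converse direction, moments of \<open>x\<close> cannot be expected to determine a measure,
  as their failure to do so is the subject; moments of the bounded function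
  \<open>1 / (a \<bullet> x + 1)\<close> do determine its distribution, by Weierstrass
  approximation. The two directions meet in one fact: the kernel integrals of all moment equivalent
  measures lie between the lower and the upper value, and Hahn--Banach shows that both ends are
  attained.\<close>

lemma polyfun_cmult: "p \<in> polyfun \<Longrightarrow> (\<lambda>x. c * p x) \<in> polyfun"
  using polyfun.mult[OF polyfun.const] by fast

lemma polyfun_uminus: "p \<in> polyfun \<Longrightarrow> (\<lambda>x. - p x) \<in> polyfun"
  using polyfun_cmult[of p "-1"] by simp

lemma polyfun_sum:
  "finite I \<Longrightarrow> (\<And>i. i \<in> I \<Longrightarrow> p i \<in> polyfun) \<Longrightarrow> (\<lambda>x. \<Sum>i\<in>I. p i x) \<in> polyfun"
  by (induction I rule: finite_induct) (auto intro: polyfun.const polyfun.add)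

lemma polyfun_inner_self: "(\<lambda>x::'a::euclidean_space. x \<bullet> x) \<in> polyfun"
proof -
  have "(\<lambda>x::'a. \<Sum>b\<in>Basis. (x \<bullet> b) * (x \<bullet> b)) \<in> polyfun"
    by (intro polyfun_sum polyfun.mult polyfun.coord) auto
  then show ?thesis
    by (subst euclidean_inner) simp
qed

lemma continuous_on_polyfun: "p \<in> polyfun \<Longrightarrow> continuous_on S p"
  by (induction rule: polyfun.induct) (auto intro!: continuous_intros)

lemma abs_le_square: "\<bar>t\<bar> \<le> 1 + t * t" for t :: real
proof -
  have "0 \<le> (\<bar>t\<bar> - 1)\<^sup>2"
    by simp
  then show ?thesis
    by (simp add: power2_eq_square algebra_simps abs_mult_self_eq)
qed

text \<open>The bound is required on \<open>X\<close> only and without continuity: indicators belong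
  to the space, and each member lies between two polynomials on \<open>X\<close>, so the infimum
  over its polynomial majorants is finite.\<close>

definition poly_bounded :: "'a::euclidean_space set \<Rightarrow> ('a \<Rightarrow> real) set" where
  "poly_bounded X = {f. \<exists>p\<in>polyfun. \<forall>x\<in>X. \<bar>f x\<bar> \<le> p x}"

lemma poly_boundedI: "p \<in> polyfun \<Longrightarrow> (\<And>x. x \<in> X \<Longrightarrow> \<bar>f x\<bar> \<le> p x) \<Longrightarrow> f \<in> poly_bounded X"
  by (auto simp: poly_bounded_def)

lemma poly_bounded_bounded: "(\<And>x. x \<in> X \<Longrightarrow> \<bar>f x\<bar> \<le> c) \<Longrightarrow> f \<in> poly_bounded X"
  using poly_boundedI[OF polyfun.const] by blast

lemma poly_bounded_polyfun: "p \<in> polyfun \<Longrightarrow> p \<in> poly_bounded X"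
  by (rule poly_boundedI[of "\<lambda>x. 1 + p x * p x"])
     (auto intro: polyfun.const polyfun.add polyfun.mult abs_le_square)

lemma poly_bounded_mono:
  "f \<in> poly_bounded X \<Longrightarrow> (\<And>x. x \<in> X \<Longrightarrow> \<bar>g x\<bar> \<le> \<bar>f x\<bar>) \<Longrightarrow> g \<in> poly_bounded X"
  unfolding poly_bounded_def by (blast intro: order_trans)

lemma poly_bounded_add:
  assumes "f \<in> poly_bounded X" "g \<in> poly_bounded X"
  shows "(\<lambda>x. f x + g x) \<in> poly_bounded X"
proof -
  obtain p q where pq: "p \<in> polyfun" "q \<in> polyfun"
    "\<And>x. x \<in> X \<Longrightarrow> \<bar>f x\<bar> \<le> p x" "\<And>x. x \<in> X \<Longrightarrow> \<bar>g x\<bar> \<le> q x"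
    using assms by (auto simp: poly_bounded_def)
  have "\<bar>f x + g x\<bar> \<le> p x + q x" if "x \<in> X" for x
    using pq(3,4)[OF that] by linarith
  then show ?thesis
    by (rule poly_boundedI[OF polyfun.add[OF pq(1,2)]])
qed

lemma poly_bounded_mult:
  assumes "f \<in> poly_bounded X" "g \<in> poly_bounded X"
  shows "(\<lambda>x. f x * g x) \<in> poly_bounded X"
proof -
  obtain p q where pq: "p \<in> polyfun" "q \<in> polyfun"
    "\<And>x. x \<in> X \<Longrightarrow> \<bar>f x\<bar> \<le> p x" "\<And>x. x \<in> X \<Longrightarrow> \<bar>g x\<bar> \<le> q x"
    using assms by (auto simp: poly_bounded_def)
  have "\<bar>f x * g x\<bar> \<le> p x * q x" if "x \<in> X" for x
    using pq(3,4)[OF that] by (auto simp: abs_mult intro: mult_mono order_trans[OF abs_ge_zero])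
  then show ?thesis
    by (rule poly_boundedI[OF polyfun.mult[OF pq(1,2)]])
qed

lemma poly_bounded_const: "(\<lambda>x. c) \<in> poly_bounded X"
  by (rule poly_bounded_polyfun) (rule polyfun.const)

lemma poly_bounded_cmult: "f \<in> poly_bounded X \<Longrightarrow> (\<lambda>x. c * f x) \<in> poly_bounded X"
  by (rule poly_bounded_mult[OF poly_bounded_const])

lemma poly_bounded_uminus: "f \<in> poly_bounded X \<Longrightarrow> (\<lambda>x. - f x) \<in> poly_bounded X"
  using poly_bounded_cmult[of f X "-1"] by simp

lemma poly_bounded_diff:
  "f \<in> poly_bounded X \<Longrightarrow> g \<in> poly_bounded X \<Longrightarrow> (\<lambda>x. f x - g x) \<in> poly_bounded X"
  using poly_bounded_add[OF _ poly_bounded_uminus, of f X g] by simp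

lemma poly_bounded_sum:
  "finite I \<Longrightarrow> (\<And>i. i \<in> I \<Longrightarrow> f i \<in> poly_bounded X) \<Longrightarrow> (\<lambda>x. \<Sum>i\<in>I. f i x) \<in> poly_bounded X"
  by (induction I rule: finite_induct) (auto intro: poly_bounded_const poly_bounded_add)

lemma poly_bounded_indicator: "(indicator A :: _ \<Rightarrow> real) \<in> poly_bounded X"
  by (rule poly_bounded_bounded[of _ _ 1]) (auto simp: indicator_def)

subsection \<open>The Hahn--Banach theorem on a space of functions\<close>

definition fun_subspace :: "('a \<Rightarrow> real) set \<Rightarrow> bool" where
  "fun_subspace E \<longleftrightarrow> (\<lambda>x. 0) \<in> E \<and> (\<forall>f\<in>E. \<forall>g\<in>E. (\<lambda>x. f x + g x) \<in> E) \<and>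
     (\<forall>f\<in>E. \<forall>c. (\<lambda>x. c * f x) \<in> E)"

definition sublinear_on :: "('a \<Rightarrow> real) set \<Rightarrow> (('a \<Rightarrow> real) \<Rightarrow> real) \<Rightarrow> bool" where
  "sublinear_on E p \<longleftrightarrow> (\<forall>f\<in>E. \<forall>g\<in>E. p (\<lambda>x. f x + g x) \<le> p f + p g) \<and>
     (\<forall>f\<in>E. \<forall>c\<ge>0. p (\<lambda>x. c * f x) = c * p f)"

definition linear_functional_on :: "('a \<Rightarrow> real) set \<Rightarrow> (('a \<Rightarrow> real) \<Rightarrow> real) \<Rightarrow> bool" where
  "linear_functional_on E L \<longleftrightarrow> (\<forall>f\<in>E. \<forall>g\<in>E. L (\<lambda>x. f x + g x) = L f + L g) \<and>
     (\<forall>f\<in>E. \<forall>c. L (\<lambda>x. c * f x) = c * L f)"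

lemma fun_subspace_add: "fun_subspace E \<Longrightarrow> f \<in> E \<Longrightarrow> g \<in> E \<Longrightarrow> (\<lambda>x. f x + g x) \<in> E"
  by (simp add: fun_subspace_def)

lemma fun_subspace_scale: "fun_subspace E \<Longrightarrow> f \<in> E \<Longrightarrow> (\<lambda>x. c * f x) \<in> E"
  by (simp add: fun_subspace_def)

lemma fun_subspace_uminus: "fun_subspace E \<Longrightarrow> f \<in> E \<Longrightarrow> (\<lambda>x. - f x) \<in> E"
  using fun_subspace_scale[of E f "-1"] by simp

lemma sublinear_on_add:
  "sublinear_on E p \<Longrightarrow> f \<in> E \<Longrightarrow> g \<in> E \<Longrightarrow> p (\<lambda>x. f x + g x) \<le> p f + p g"
  by (simp add: sublinear_on_def)

lemma sublinear_on_scale: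
  "sublinear_on E p \<Longrightarrow> f \<in> E \<Longrightarrow> 0 \<le> c \<Longrightarrow> p (\<lambda>x. c * f x) = c * p f"
  by (simp add: sublinear_on_def)

lemma sublinear_on_zero: "fun_subspace E \<Longrightarrow> sublinear_on E p \<Longrightarrow> p (\<lambda>x. 0) = 0"
  using sublinear_on_scale[of E p "\<lambda>x. 0" 0] by (simp add: fun_subspace_def)

lemma sublinear_on_ge:
  assumes "fun_subspace E" "sublinear_on E p" "f \<in> E"
  shows "- p (\<lambda>x. - f x) \<le> p f"
proof -
  have m: "(\<lambda>x. - f x) \<in> E"
    using assms(1,3) by (rule fun_subspace_uminus)
  have "p (\<lambda>x. f x + - f x) \<le> p f + p (\<lambda>x. - f x)"
    using assms(2,3) m by (rule sublinear_on_add)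
  then show ?thesis
    using sublinear_on_zero[OF assms(1,2)] by simp
qed

lemma scaled_Inf:
  fixes S :: "real set"
  assumes "S \<noteq> {}" "bdd_below S" "c > 0"
  shows "Inf ((\<lambda>s. c * s) ` S) = c * Inf S"
proof (rule cInf_eq_non_empty)
  show "(\<lambda>s. c * s) ` S \<noteq> {}"
    using assms by simp
  show "c * Inf S \<le> x" if "x \<in> (\<lambda>s. c * s) ` S" for x
    using that assms by (auto intro: cInf_lower)
  fix y
  assume y: "\<And>x. x \<in> (\<lambda>s. c * s) ` S \<Longrightarrow> y \<le> x"
  have "y / c \<le> Inf S"
    using y assms by (intro cInf_greatest) (auto simp: field_simps)
  then show "y \<le> c * Inf S"
    using assms by (simp add: field_simps)
qed

text \<open>Lowering a sublinear functional along the direction \<open>g\<close> makes it superadditive in \<open>g\<close>.\<close>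

definition lowered :: "(('a \<Rightarrow> real) \<Rightarrow> real) \<Rightarrow> ('a \<Rightarrow> real) \<Rightarrow> ('a \<Rightarrow> real) \<Rightarrow> real" where
  "lowered q g f = (INF t\<in>{0..}. q (\<lambda>x. f x + t * g x) - t * q g)"

text \<open>The bound is \<open>- q (\<lambda>x. - f x)\<close>, from subadditivity applied to
  \<open>t * g = (f + t * g) - f\<close>. Without it the real infimum in \<open>lowered\<close>
  would carry no information.\<close>

lemma lowered_bdd_below:
  assumes E: "fun_subspace E" and q: "sublinear_on E q" and "f \<in> E" "g \<in> E"
  shows "bdd_below ((\<lambda>t. q (\<lambda>x. f x + t * g x) - t * q g) ` {0..})"
proof (rule bdd_belowI2)
  fix t :: real
  assume t: "t \<in> {0..}"
  have m: "(\<lambda>x. - f x) \<in> E"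
    using E \<open>f \<in> E\<close> by (rule fun_subspace_uminus)
  have s: "(\<lambda>x. f x + t * g x) \<in> E"
    by (intro fun_subspace_add fun_subspace_scale assms)
  have "q (\<lambda>x. (f x + t * g x) + - f x) \<le> q (\<lambda>x. f x + t * g x) + q (\<lambda>x. - f x)"
    using q s m by (rule sublinear_on_add)
  moreover have "q (\<lambda>x. t * g x) = t * q g"
    using t by (intro sublinear_on_scale[OF q \<open>g \<in> E\<close>]) simp
  ultimately show "- q (\<lambda>x. - f x) \<le> q (\<lambda>x. f x + t * g x) - t * q g"
    by simp
qed

lemma lowered_le:
  assumes "fun_subspace E" "sublinear_on E q" "f \<in> E" "g \<in> E" "t \<ge> 0"
  shows "lowered q g f \<le> q (\<lambda>x. f x + t * g x) - t * q g"
  unfolding lowered_def using assms by (intro cINF_lower lowered_bdd_below) auto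

text \<open>Parameters \<open>s\<close> for \<open>f\<close> and \<open>t\<close> for
  \<open>f'\<close> combine to \<open>s + t\<close> for the sum; scaling by \<open>c > 0\<close>
  rescales the parameter by \<open>c\<close>.\<close>

lemma sublinear_on_lowered:
  assumes E: "fun_subspace E" and q: "sublinear_on E q" and g: "g \<in> E"
  shows "sublinear_on E (lowered q g)"
  unfolding sublinear_on_def
proof (intro conjI ballI allI impI)
  fix f f'
  assume f: "f \<in> E" "f' \<in> E"
  have in_E: "(\<lambda>x. h x + t * g x) \<in> E" if "h \<in> E" for h t
    by (intro fun_subspace_add fun_subspace_scale E that g)
  have ff: "(\<lambda>x. f x + f' x) \<in> E"
    by (intro fun_subspace_add E f)
  have *: "lowered q g (\<lambda>x. f x + f' x) \<le>
      (q (\<lambda>x. f x + s * g x) - s * q g) + (q (\<lambda>x. f' x + t * g x) - t * q g)"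
    if "s \<ge> 0" "t \<ge> 0" for s t
  proof -
    have "lowered q g (\<lambda>x. f x + f' x) \<le> q (\<lambda>x. (f x + f' x) + (s + t) * g x) - (s + t) * q g"
      using lowered_le[OF E q ff g] that by simp
    also have "(\<lambda>x. (f x + f' x) + (s + t) * g x) = (\<lambda>x. (f x + s * g x) + (f' x + t * g x))"
      by (simp add: algebra_simps)
    also have "q \<dots> \<le> q (\<lambda>x. f x + s * g x) + q (\<lambda>x. f' x + t * g x)"
      by (intro sublinear_on_add[OF q] in_E f)
    finally show ?thesis
      by (simp add: algebra_simps)
  qed
  have "lowered q g (\<lambda>x. f x + f' x) - (q (\<lambda>x. f x + s * g x) - s * q g) \<le> lowered q g f'"
    if "s \<ge> 0" for s
    unfolding lowered_def[of q g f']
    using *[OF that] by (intro cINF_greatest) (auto simp: algebra_simps)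
  then have "lowered q g (\<lambda>x. f x + f' x) - lowered q g f' \<le> lowered q g f"
    unfolding lowered_def[of q g f] by (intro cINF_greatest) (auto simp: algebra_simps)
  then show "lowered q g (\<lambda>x. f x + f' x) \<le> lowered q g f + lowered q g f'"
    by simp
next
  fix f and c :: real
  assume f: "f \<in> E" and "0 \<le> c"
  show "lowered q g (\<lambda>x. c * f x) = c * lowered q g f"
  proof (cases "c = 0")
    case True
    have "q (\<lambda>x. t * g x) = t * q g" if "t \<ge> 0" for t
      by (rule sublinear_on_scale[OF q g that])
    then show ?thesis
      using True by (simp add: lowered_def)
  next
    case False
    with \<open>0 \<le> c\<close> have c: "c > 0"
      by simp
    let ?F = "\<lambda>t. q (\<lambda>x. f x + t * g x) - t * q g"
    have "(\<lambda>t. q (\<lambda>x. c * f x + t * g x) - t * q g) ` {0..} = (\<lambda>s. c * s) ` ?F ` {0..}"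
      (is "?H ` _ = _")
    proof -
      have H: "?H (c * t) = c * ?F t" for t
      proof -
        have "(\<lambda>x. f x + t * g x) \<in> E"
          by (intro fun_subspace_add fun_subspace_scale E f g)
        then have "q (\<lambda>x. c * (f x + t * g x)) = c * q (\<lambda>x. f x + t * g x)"
          using c by (intro sublinear_on_scale[OF q]) auto
        then show ?thesis
          by (simp add: algebra_simps)
      qed
      have "{0..} = (\<lambda>t. c * t) ` {0::real..}"
      proof -
        have "t \<in> (\<lambda>t. c * t) ` {0..}" if "t \<ge> 0" for t
          using that c by (intro image_eqI[of _ _ "t / c"]) auto
        then show ?thesis
          using c by auto
      qed
      then have "?H ` {0..} = ?H ` (\<lambda>t. c * t) ` {0..}"
        by simp
      also have "\<dots> = (\<lambda>s. c * s) ` ?F ` {0..}"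
        unfolding image_image H ..
      finally show ?thesis .
    qed
    then show ?thesis
      unfolding lowered_def
      using scaled_Inf[OF _ lowered_bdd_below[OF E q f g] c] by simp
  qed
qed

text \<open>In a chain, one member \<open>s\<close> lies below both \<open>q\<close> and
  \<open>r\<close>, so \<open>s (f + g) \<le> q f + r g\<close>; for an arbitrary family this could
  fail. The bound \<open>p\<close> keeps the infimum finite, through
  \<open>- p (- f) \<le> q f\<close>.\<close>

lemma Inf_chain_sublinear:
  assumes E: "fun_subspace E" and "C \<noteq> {}"
    and sub: "\<And>q. q \<in> C \<Longrightarrow> sublinear_on E q"
    and le: "\<And>q f. q \<in> C \<Longrightarrow> f \<in> E \<Longrightarrow> q f \<le> p f"
    and chain: "\<And>q r. q \<in> C \<Longrightarrow> r \<in> C \<Longrightarrow> (\<forall>f\<in>E. q f \<le> r f) \<or> (\<forall>f\<in>E. r f \<le> q f)"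
  shows "sublinear_on E (\<lambda>f. INF q\<in>C. q f)" (is ?sub)
    and "\<And>q f. q \<in> C \<Longrightarrow> f \<in> E \<Longrightarrow> (INF q\<in>C. q f) \<le> q f"
proof -
  have bdd: "bdd_below ((\<lambda>q. q f) ` C)" if f: "f \<in> E" for f
  proof (rule bdd_belowI2)
    fix q
    assume q: "q \<in> C"
    have m: "(\<lambda>x. - f x) \<in> E"
      using E f by (rule fun_subspace_uminus)
    show "- p (\<lambda>x. - f x) \<le> q f"
      using sublinear_on_ge[OF E sub[OF q] f] le[OF q m] by simp
  qed
  then show lower: "(INF q\<in>C. q f) \<le> q f" if "q \<in> C" "f \<in> E" for q f
    using that by (intro cINF_lower) auto
  show ?sub
    unfolding sublinear_on_def
  proof (intro conjI ballI allI impI)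
    fix f g
    assume f: "f \<in> E" "g \<in> E"
    then have fg: "(\<lambda>x. f x + g x) \<in> E"
      by (intro fun_subspace_add E)
    have *: "(INF q\<in>C. q (\<lambda>x. f x + g x)) \<le> q f + r g" if qr: "q \<in> C" "r \<in> C" for q r
    proof -
      obtain s where s: "s \<in> C" "s f \<le> q f" "s g \<le> r g"
        using chain[OF qr] qr f by blast
      have "(INF q\<in>C. q (\<lambda>x. f x + g x)) \<le> s (\<lambda>x. f x + g x)"
        using lower[OF s(1) fg] .
      also have "\<dots> \<le> s f + s g"
        by (intro sublinear_on_add[OF sub[OF s(1)]] f)
      finally show ?thesis
        using s by simp
    qed
    have "(INF q\<in>C. q (\<lambda>x. f x + g x)) - q f \<le> (INF q\<in>C. q g)" if "q \<in> C" for q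
      using *[OF that] \<open>C \<noteq> {}\<close> by (intro cINF_greatest) (auto simp: algebra_simps)
    then have "(INF q\<in>C. q (\<lambda>x. f x + g x)) - (INF q\<in>C. q g) \<le> (INF q\<in>C. q f)"
      using \<open>C \<noteq> {}\<close> by (intro cINF_greatest) (auto simp: algebra_simps)
    then show "(INF q\<in>C. q (\<lambda>x. f x + g x)) \<le> (INF q\<in>C. q f) + (INF q\<in>C. q g)"
      by simp
  next
    fix f and c :: real
    assume f: "f \<in> E" and c: "0 \<le> c"
    have "(\<lambda>q. q (\<lambda>x. c * f x)) ` C = (\<lambda>q. c * q f) ` C"
      by (intro image_cong refl sublinear_on_scale[OF sub] f c)
    then have *: "(INF q\<in>C. q (\<lambda>x. c * f x)) = (INF q\<in>C. c * q f)"
      by simp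
    show "(INF q\<in>C. q (\<lambda>x. c * f x)) = c * (INF q\<in>C. q f)"
    proof (cases "c = 0")
      case True
      then show ?thesis
        using * \<open>C \<noteq> {}\<close> by simp
    next
      case False
      then show ?thesis
        unfolding * using scaled_Inf[OF _ bdd[OF f], of c] c \<open>C \<noteq> {}\<close>
        by (simp add: image_image)
    qed
  qed
qed

text \<open>A pointwise minimal sublinear functional is linear, since it cannot be lowered.\<close>

theorem Hahn_Banach_function_space:
  assumes E: "fun_subspace E" and p: "sublinear_on E p"
  obtains L where "linear_functional_on E L" "\<And>f. f \<in> E \<Longrightarrow> L f \<le> p f"
proof -
  \<comment> \<open>Functionals are total functions; without the value 0 off \<open>E\<close> they
    could be lowered there forever and no minimal one would exist.\<close>
  define A where "A = {q. sublinear_on E q \<and> (\<forall>f\<in>E. q f \<le> p f) \<and> (\<forall>f. f \<notin> E \<longrightarrow> q f = 0)}"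
  \<comment> \<open>The order is reversed, so a maximal element for \<open>P\<close> is a minimal
    functional.\<close>
  define P where "P = (\<lambda>q r :: ('a \<Rightarrow> real) \<Rightarrow> real. \<forall>f. r f \<le> q f)"
  have restrict: "sublinear_on E (\<lambda>f. if f \<in> E then q f else 0)" if "sublinear_on E q" for q
    using that E unfolding sublinear_on_def fun_subspace_def by auto
  have "\<exists>m\<in>A. \<forall>a\<in>A. P m a \<longrightarrow> a = m"
  proof (rule predicate_Zorn)
    show "partial_order_on A (relation_of P A)"
      by (rule partial_order_on_relation_ofI)
         (auto simp: P_def fun_eq_iff intro: order_trans order_antisym)
    fix C
    assume "C \<in> Chains (relation_of P A)"
    then have CA: "C \<subseteq> A" and chain: "\<And>q r. q \<in> C \<Longrightarrow> r \<in> C \<Longrightarrow> P q r \<or> P r q"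
      by (auto simp: Chains_def relation_of_def)
    show "\<exists>u\<in>A. \<forall>a\<in>C. P a u"
    proof (cases "C = {}")
      case True
      have "(\<lambda>f. if f \<in> E then p f else 0) \<in> A"
        using restrict[OF p] by (simp add: A_def)
      then show ?thesis
        using True by blast
    next
      case False
      define u where "u = (\<lambda>f. INF q\<in>C. q f)"
      have sub: "sublinear_on E q" if "q \<in> C" for q
        using that CA by (auto simp: A_def)
      have le: "q f \<le> p f" if "q \<in> C" "f \<in> E" for q f
        using that CA by (auto simp: A_def)
      have dir: "(\<forall>f\<in>E. q f \<le> r f) \<or> (\<forall>f\<in>E. r f \<le> q f)" if "q \<in> C" "r \<in> C" for q r
        using chain[OF that] unfolding P_def by blast
      have u: "sublinear_on E u"
        unfolding u_def by (rule Inf_chain_sublinear(1)[where p = p]) (fact E False sub le dir)+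
      have ule: "u f \<le> q f" if "q \<in> C" "f \<in> E" for q f
        unfolding u_def
        by (rule Inf_chain_sublinear(2)[where p = p]) (fact E False sub le dir that)+
      have off: "q f = 0" if "q \<in> C" "f \<notin> E" for q f
        using that CA by (auto simp: A_def)
      have "u f \<le> p f" if "f \<in> E" for f
        using ule le False that by (meson ex_in_conv order_trans)
      then have "(\<lambda>f. if f \<in> E then u f else 0) \<in> A"
        using restrict[OF u] by (simp add: A_def)
      moreover have "P q (\<lambda>f. if f \<in> E then u f else 0)" if "q \<in> C" for q
        using ule[OF that] off[OF that] by (auto simp: P_def)
      ultimately show ?thesis
        by blast
    qed
  qed
  then obtain m where m: "m \<in> A" and min: "\<And>a. a \<in> A \<Longrightarrow> P m a \<Longrightarrow> a = m"
    by blast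
  have sub: "sublinear_on E m" and le: "\<And>f. f \<in> E \<Longrightarrow> m f \<le> p f"
    and off: "\<And>f. f \<notin> E \<Longrightarrow> m f = 0"
    using m by (auto simp: A_def)
  have add: "m (\<lambda>x. f x + g x) = m f + m g" if fg: "f \<in> E" "g \<in> E" for f g
  proof (rule antisym)
    show "m (\<lambda>x. f x + g x) \<le> m f + m g"
      by (rule sublinear_on_add[OF sub fg])
    define a where "a = (\<lambda>f. if f \<in> E then lowered m g f else 0)"
    have low: "lowered m g h \<le> m h" if "h \<in> E" for h
      using lowered_le[OF E sub that fg(2), of 0] by simp
    have "a \<in> A"
      using restrict[OF sublinear_on_lowered[OF E sub fg(2)]] low le
      by (auto simp: A_def a_def intro: order_trans)
    moreover have "P m a"
      using low off by (auto simp: P_def a_def)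
    ultimately have "a = m"
      by (rule min)
    then have "m f = lowered m g f"
      using fg by (metis a_def)
    \<comment> \<open>With \<open>t = 1\<close> the infimum gives
      \<open>m f \<le> m (f + g) - m g\<close>, the missing superadditivity.\<close>
    then show "m f + m g \<le> m (\<lambda>x. f x + g x)"
      using lowered_le[OF E sub fg, of 1] by simp
  qed
  have neg: "m (\<lambda>x. - f x) = - m f" if f: "f \<in> E" for f
  proof -
    have "(\<lambda>x. - f x) \<in> E"
      using E f by (rule fun_subspace_uminus)
    from add[OF f this] show ?thesis
      using sublinear_on_zero[OF E sub] by simp
  qed
  have scale: "m (\<lambda>x. c * f x) = c * m f" if f: "f \<in> E" for f c
  proof (cases "c \<ge> 0")
    case True
    then show ?thesis
      by (rule sublinear_on_scale[OF sub f])
  next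
    case False
    have cf: "(\<lambda>x. - c * f x) \<in> E"
      by (rule fun_subspace_scale[OF E f])
    have "m (\<lambda>x. - c * f x) = - c * m f"
      using False by (intro sublinear_on_scale[OF sub f]) simp
    then show ?thesis
      using neg[OF cf] by simp
  qed
  show thesis
    using that[of m] add scale le by (simp add: linear_functional_on_def)
qed

text \<open>Domination by \<open>lowered p g\<close> instead of \<open>p\<close> does it: at
  \<open>- g\<close> with \<open>t = 1\<close> it reads \<open>L (- g) \<le> p 0 - p g\<close>,
  hence \<open>p g \<le> L g\<close>.\<close>

corollary Hahn_Banach_attained:
  assumes E: "fun_subspace E" and p: "sublinear_on E p" and g: "g \<in> E"
  obtains L where "linear_functional_on E L" "\<And>f. f \<in> E \<Longrightarrow> L f \<le> p f" "L g = p g"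
proof -
  obtain L where L: "linear_functional_on E L" "\<And>f. f \<in> E \<Longrightarrow> L f \<le> lowered p g f"
    using Hahn_Banach_function_space[OF E sublinear_on_lowered[OF E p g]] by blast
  have le: "L f \<le> p f" if "f \<in> E" for f
    using L(2)[OF that] lowered_le[OF E p that g, of 0] by simp
  have m: "(\<lambda>x. - 1 * g x) \<in> E"
    by (rule fun_subspace_scale[OF E g])
  have "L (\<lambda>x. - 1 * g x) = - 1 * L g"
    using L(1) g by (simp only: linear_functional_on_def)
  moreover have "L (\<lambda>x. - 1 * g x) \<le> - p g"
    using L(2)[OF m] lowered_le[OF E p m g, of 1] sublinear_on_zero[OF E p] by simp
  ultimately have "L g = p g"
    using le[OF g] by simp
  then show thesis
    using that L(1) le by blast
qed


subsection \<open>Riesz representation of positive functionals\<close>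

text \<open>Positivity is tested on \<open>X\<close> only, so \<open>L f\<close> depends only on the
  values of \<open>f\<close> on \<open>X\<close>.\<close>

locale positive_functional =
  fixes X :: "'a::euclidean_space set" and L :: "('a \<Rightarrow> real) \<Rightarrow> real"
  assumes closed_X: "closed X"
    and linear: "linear_functional_on (poly_bounded X) L"
    and nonneg: "\<And>f. f \<in> poly_bounded X \<Longrightarrow> (\<And>x. x \<in> X \<Longrightarrow> 0 \<le> f x) \<Longrightarrow> 0 \<le> L f"
begin

lemma L_add: "f \<in> poly_bounded X \<Longrightarrow> g \<in> poly_bounded X \<Longrightarrow> L (\<lambda>x. f x + g x) = L f + L g"
  using linear by (simp add: linear_functional_on_def)

lemma L_scale: "f \<in> poly_bounded X \<Longrightarrow> L (\<lambda>x. c * f x) = c * L f"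
  using linear by (simp add: linear_functional_on_def)

lemma L_zero: "L (\<lambda>x. 0) = 0"
  using L_scale[OF poly_bounded_const, of 0 0] by simp

lemma L_diff:
  assumes "f \<in> poly_bounded X" "g \<in> poly_bounded X"
  shows "L (\<lambda>x. f x - g x) = L f - L g"
  using L_add[OF assms(1) poly_bounded_uminus[OF assms(2)]] L_scale[OF assms(2), of "-1"] by simp

lemma L_mono:
  assumes "f \<in> poly_bounded X" "g \<in> poly_bounded X" "\<And>x. x \<in> X \<Longrightarrow> f x \<le> g x"
  shows "L f \<le> L g"
  using nonneg[OF poly_bounded_diff[OF assms(2,1)]] L_diff[OF assms(2,1)] assms(3) by simp

lemma L_sum:
  "finite I \<Longrightarrow> (\<And>i. i \<in> I \<Longrightarrow> f i \<in> poly_bounded X) \<Longrightarrow> L (\<lambda>x. \<Sum>i\<in>I. f i x) = (\<Sum>i\<in>I. L (f i))"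
proof (induction I rule: finite_induct)
  case empty
  then show ?case
    by (simp add: L_zero)
next
  case (insert i I)
  have "L (\<lambda>x. f i x + (\<Sum>i\<in>I. f i x)) = L (f i) + L (\<lambda>x. \<Sum>i\<in>I. f i x)"
    using insert by (intro L_add poly_bounded_sum) auto
  then show ?case
    using insert by simp
qed

section \<open>An outer integral from covers by continuous functions\<close>

definition test_funs :: "('a \<Rightarrow> real) set" where
  "test_funs = {g \<in> poly_bounded X. continuous_on UNIV g \<and> (\<forall>x. 0 \<le> g x)}"

text \<open>A Daniell-type outer integral. Countable covers make it countably subadditive, and the
  cover is demanded only on \<open>X\<close>, which later gives the complement of \<open>X\<close>
  measure zero.\<close>

definition upper_integral :: "('a \<Rightarrow> ennreal) \<Rightarrow> ennreal" where
  "upper_integral f = (INF g\<in>{g :: nat \<Rightarrow> 'a \<Rightarrow> real. (\<forall>i. g i \<in> test_funs) \<and>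
      (\<forall>x\<in>X. f x \<le> (\<Sum>i. ennreal (g i x)))}. \<Sum>i. ennreal (L (g i)))"

lemma test_funsD:
  assumes "g \<in> test_funs"
  shows "g \<in> poly_bounded X" "continuous_on UNIV g" "0 \<le> g x"
  using assms by (auto simp: test_funs_def)

lemma test_fun_L_nonneg: "g \<in> test_funs \<Longrightarrow> 0 \<le> L g"
  by (auto intro!: nonneg dest: test_funsD)

lemma upper_integral_le:
  "(\<And>i. g i \<in> test_funs) \<Longrightarrow> (\<And>x. x \<in> X \<Longrightarrow> f x \<le> (\<Sum>i. ennreal (g i x))) \<Longrightarrow>
    upper_integral f \<le> (\<Sum>i. ennreal (L (g i)))"
  unfolding upper_integral_def by (rule INF_lower) auto

lemma upper_integral_mono:
  "(\<And>x. x \<in> X \<Longrightarrow> f x \<le> f' x) \<Longrightarrow> upper_integral f \<le> upper_integral f'"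
  unfolding upper_integral_def by (rule INF_superset_mono) (auto intro: order_trans)

lemma upper_integral_test_fun:
  assumes "g \<in> test_funs"
  shows "upper_integral (\<lambda>x. ennreal (g x)) \<le> ennreal (L g)"
proof -
  define h where "h = (\<lambda>i::nat. if i = 0 then g else (\<lambda>x. 0))"
  have "h i \<in> test_funs" for i
    using assms by (auto simp: h_def test_funs_def poly_bounded_const)
  moreover have "(\<Sum>i. ennreal (h i x)) = ennreal (g x)" for x
    by (subst suminf_finite[of "{0}"]) (auto simp: h_def)
  ultimately have "upper_integral (\<lambda>x. ennreal (g x)) \<le> (\<Sum>i. ennreal (L (h i)))"
    by (intro upper_integral_le) auto
  also have "\<dots> = ennreal (L g)"
    by (subst suminf_finite[of "{0}"]) (auto simp: h_def L_zero)
  finally show ?thesis .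
qed

text \<open>Covers within \<open>e * (1/2)^Suc n\<close> of optimal are merged into one sequence by
  the pairing function.\<close>

lemma upper_integral_suminf:
  "upper_integral (\<lambda>x. \<Sum>n. f n x) \<le> (\<Sum>n. upper_integral (f n))"
proof (rule ennreal_le_epsilon)
  fix e :: real
  assume e: "0 < e" and fin: "(\<Sum>n. upper_integral (f n)) < top"
  have *: "upper_integral (f n) < upper_integral (f n) + ennreal (e * (1/2)^Suc n)" for n
    using e ennreal_suminf_lessD[OF fin, of n] by (auto simp: less_top)
  have "\<exists>g. (\<forall>i. g i \<in> test_funs) \<and> (\<forall>x\<in>X. f n x \<le> (\<Sum>i. ennreal (g i x))) \<and>
      (\<Sum>i. ennreal (L (g i))) \<le> upper_integral (f n) + ennreal (e * (1/2)^Suc n)" for n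
  proof -
    obtain g where "(\<forall>i. g i \<in> test_funs) \<and> (\<forall>x\<in>X. f n x \<le> (\<Sum>i. ennreal (g i x)))"
      "(\<Sum>i. ennreal (L (g i))) < upper_integral (f n) + ennreal (e * (1/2)^Suc n)"
      using *[of n] unfolding upper_integral_def[of "f n"] INF_less_iff by blast
    then show ?thesis
      by (intro exI[of _ g]) auto
  qed
  then obtain g where g: "\<And>n i. g n i \<in> test_funs"
    "\<And>n x. x \<in> X \<Longrightarrow> f n x \<le> (\<Sum>i. ennreal (g n i x))"
    "\<And>n. (\<Sum>i. ennreal (L (g n i))) \<le> upper_integral (f n) + ennreal (e * (1/2)^Suc n)"
    by metis
  define h where "h = (\<lambda>k. case prod_decode k of (n, i) \<Rightarrow> g n i)"
  have h: "h k \<in> test_funs" for k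
    using g(1) by (auto simp: h_def split: prod.split)
  have "(\<Sum>n. f n x) \<le> (\<Sum>k. ennreal (h k x))" if "x \<in> X" for x
  proof -
    have "(\<Sum>k. ennreal (h k x)) = (\<Sum>n. \<Sum>i. ennreal (g n i x))"
      using suminf_ennreal_2dimen[of "\<lambda>n. \<Sum>i. ennreal (g n i x)" "\<lambda>(n, i). ennreal (g n i x)"]
      by (simp add: h_def split_def)
    then show ?thesis
      using g(2)[OF that] by (auto intro: suminf_le)
  qed
  then have "upper_integral (\<lambda>x. \<Sum>n. f n x) \<le> (\<Sum>k. ennreal (L (h k)))"
    using h by (rule upper_integral_le[rotated])
  also have "\<dots> = (\<Sum>n. \<Sum>i. ennreal (L (g n i)))"
    using suminf_ennreal_2dimen[of "\<lambda>n. \<Sum>i. ennreal (L (g n i))" "\<lambda>(n, i). ennreal (L (g n i))"]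
    by (simp add: h_def split_def)
  also have "\<dots> \<le> (\<Sum>n. upper_integral (f n) + ennreal (e * (1/2)^Suc n))"
    using g(3) by (intro suminf_le) auto
  also have "\<dots> = (\<Sum>n. upper_integral (f n)) + (\<Sum>n. ennreal (e * (1/2)^Suc n))"
    by (subst suminf_add[symmetric]) auto
  also have "(\<Sum>n. ennreal (e * (1/2)^Suc n)) = ennreal e"
    using e sums_mult[OF power_half_series, of e]
    by (intro suminf_ennreal_eq) auto
  finally show "upper_integral (\<lambda>x. \<Sum>n. f n x) \<le> (\<Sum>n. upper_integral (f n)) + ennreal e" .
qed

text \<open>The telescoping sum of \<open>g * (h n - h (Suc n))\<close>, where \<open>h n\<close> decreases to the indicator
  of \<open>C\<close>, covers \<open>g\<close> off \<open>C\<close>.\<close>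

lemma upper_integral_split:
  assumes g: "g \<in> test_funs" and C: "closed C"
  shows "upper_integral (\<lambda>x. ennreal (g x) * indicator C x) +
    upper_integral (\<lambda>x. ennreal (g x) * indicator (- C) x) \<le> ennreal (L g)"
proof (cases "C = {}")
  \<comment> \<open>\<open>infdist x {}\<close> is 0 by convention, so for empty \<open>C\<close>
    the functions \<open>h n\<close> below would be constantly 1.\<close>
  case True
  have "upper_integral (\<lambda>x. 0) \<le> ennreal (L (\<lambda>x. 0))"
    using upper_integral_test_fun[of "\<lambda>x. 0"] by (simp add: test_funs_def poly_bounded_const)
  then show ?thesis
    using True upper_integral_test_fun[OF g] by (simp add: L_zero)
next
  case False
  define h where "h = (\<lambda>(n::nat) x. max 0 (1 - real n * infdist x C))"
  have h01: "0 \<le> h n x" "h n x \<le> 1" for n x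
    by (auto simp: h_def infdist_nonneg)
  have h0: "h 0 x = 1" for x
    by (simp add: h_def)
  have hmono: "h (Suc n) x \<le> h n x" for n x
    using infdist_nonneg[of x C] by (auto simp: h_def algebra_simps)
  have hC: "h n x = 1" if "x \<in> C" for n x
    using that by (simp add: h_def)
  have hcont: "continuous_on UNIV (h n)" for n
    unfolding h_def by (intro continuous_intros)
  have hE: "h n \<in> poly_bounded X" for n
    using h01 by (intro poly_bounded_bounded[of _ _ 1]) (simp add: abs_le_iff order_trans[of _ 0])
  have gh: "(\<lambda>x. g x * h n x) \<in> test_funs" for n
    using test_funsD[OF g] h01 hcont hE
    by (auto simp: test_funs_def intro!: poly_bounded_mult continuous_intros)
  have gd: "(\<lambda>x. g x * h n x - g x * h (Suc n) x) \<in> test_funs" for n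
    using test_funsD[OF g] hmono hcont hE
    by (auto simp: test_funs_def intro!: poly_bounded_mult poly_bounded_diff continuous_intros mult_left_mono)
  have in_C: "upper_integral (\<lambda>x. ennreal (g x) * indicator C x) \<le> ennreal (L (\<lambda>x. g x * h n x))" for n
    by (rule order_trans[OF upper_integral_mono upper_integral_test_fun[OF gh]])
       (auto simp: indicator_def hC)
  have "ennreal (g x) * indicator (- C) x \<le> (\<Sum>n. ennreal (g x * h n x - g x * h (Suc n) x))" for x
  proof (cases "x \<in> C")
    case False
    then have pos: "infdist x C > 0"
      using C \<open>C \<noteq> {}\<close> infdist_nonneg[of x C] in_closed_iff_infdist_zero[of C x] by fastforce
    obtain N where "1 < real N * infdist x C"
      using reals_Archimedean3[OF pos] by blast
    then have hN: "h N x = 0"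
      by (simp add: h_def)
    have "ennreal (g x) = ennreal (\<Sum>n<N. g x * h n x - g x * h (Suc n) x)"
      using hN h0[of x] by (subst sum_lessThan_telescope') simp
    also have "\<dots> = (\<Sum>n<N. ennreal (g x * h n x - g x * h (Suc n) x))"
      using test_funsD(3)[OF gd] by (subst sum_ennreal) auto
    also have "\<dots> \<le> (\<Sum>n. ennreal (g x * h n x - g x * h (Suc n) x))"
      by (intro sum_le_suminf) auto
    finally show ?thesis
      by (simp add: indicator_def)
  qed simp
  then have "upper_integral (\<lambda>x. ennreal (g x) * indicator (- C) x) \<le>
      (\<Sum>n. ennreal (L (\<lambda>x. g x * h n x - g x * h (Suc n) x)))"
    using gd by (intro upper_integral_le)
  moreover have "(\<Sum>n. ennreal (L (\<lambda>x. g x * h n x - g x * h (Suc n) x))) =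
      (SUP N. \<Sum>n<N. ennreal (L (\<lambda>x. g x * h n x - g x * h (Suc n) x)))"
    by (rule suminf_eq_SUP)
  moreover have "(\<Sum>n<N. ennreal (L (\<lambda>x. g x * h n x - g x * h (Suc n) x))) =
      ennreal (L g - L (\<lambda>x. g x * h N x))" for N
  proof -
    have "(\<Sum>n<N. ennreal (L (\<lambda>x. g x * h n x - g x * h (Suc n) x))) =
        ennreal (\<Sum>n<N. L (\<lambda>x. g x * h n x) - L (\<lambda>x. g x * h (Suc n) x))"
      using test_fun_L_nonneg[OF gd] test_funsD(1)[OF gh]
      by (subst sum_ennreal[symmetric]) (auto simp: L_diff)
    also have "(\<Sum>n<N. L (\<lambda>x. g x * h n x) - L (\<lambda>x. g x * h (Suc n) x)) = L g - L (\<lambda>x. g x * h N x)"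
      by (subst sum_lessThan_telescope') (simp add: h0)
    finally show ?thesis .
  qed
  ultimately have "upper_integral (\<lambda>x. ennreal (g x) * indicator C x) +
      upper_integral (\<lambda>x. ennreal (g x) * indicator (- C) x) \<le>
      upper_integral (\<lambda>x. ennreal (g x) * indicator C x) + (SUP N. ennreal (L g - L (\<lambda>x. g x * h N x)))"
    by (simp add: add_left_mono)
  also have "\<dots> = (SUP N. upper_integral (\<lambda>x. ennreal (g x) * indicator C x) +
      ennreal (L g - L (\<lambda>x. g x * h N x)))"
    by (rule ennreal_SUP_add_right) simp
  \<comment> \<open>The same \<open>N\<close> occurs in the bound \<open>in_C\<close> and in the
    partial sum, so the two values of \<open>L\<close> add up to exactly \<open>L g\<close>, without
    passing to the limit inside \<open>L\<close>.\<close>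
  also have "\<dots> \<le> ennreal (L g)"
  proof (rule SUP_least)
    fix N
    have "L (\<lambda>x. g x * h N x) \<le> L g"
      using test_funsD(1)[OF gh] test_funsD[OF g] h01
      by (intro L_mono) (auto intro: mult_left_le)
    then have "ennreal (L (\<lambda>x. g x * h N x)) + ennreal (L g - L (\<lambda>x. g x * h N x)) = ennreal (L g)"
      using test_fun_L_nonneg[OF gh] by (simp flip: ennreal_plus)
    then show "upper_integral (\<lambda>x. ennreal (g x) * indicator C x) +
        ennreal (L g - L (\<lambda>x. g x * h N x)) \<le> ennreal (L g)"
      using in_C[of N] by (metis add_right_mono)
  qed
  finally show ?thesis .
qed

section \<open>Caratheodory extension to a Borel measure\<close>

definition outer_mu :: "'a set \<Rightarrow> ennreal" where
  "outer_mu A = upper_integral (indicator A)"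

lemma outer_measure_space_outer_mu: "outer_measure_space (Pow UNIV) outer_mu"
  unfolding outer_measure_space_def
proof (intro conjI)
  have "upper_integral (\<lambda>x. 0) \<le> ennreal (L (\<lambda>x. 0))"
    using upper_integral_test_fun[of "\<lambda>x. 0"] by (simp add: test_funs_def poly_bounded_const)
  moreover have "indicator {} = (\<lambda>x::'a. 0::ennreal)"
    by (simp add: fun_eq_iff)
  ultimately show "positive (Pow UNIV) outer_mu"
    by (simp add: positive_def outer_mu_def L_zero)
  show "increasing (Pow UNIV) outer_mu"
    unfolding increasing_def outer_mu_def
    by (auto intro!: upper_integral_mono split: split_indicator)
  show "countably_subadditive (Pow UNIV) outer_mu"
    unfolding countably_subadditive_def outer_mu_def
  proof (intro allI impI)
    fix A :: "nat \<Rightarrow> 'a set"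
    assume "disjoint_family A"
    then show "upper_integral (indicator (\<Union> (range A))) \<le> (\<Sum>i. upper_integral (indicator (A i)))"
      using upper_integral_suminf[of "\<lambda>i. indicator (A i)"] by (simp add: suminf_indicator)
  qed
qed

text \<open>Given a cover of \<open>A\<close>, each \<open>g i\<close> is split along
  \<open>C\<close> by \<open>upper_integral_split\<close>; the parts on and off \<open>C\<close>
  cover \<open>A \<inter> C\<close> and \<open>A - C\<close>, and summing gives the Caratheodory
  criterion.\<close>

lemma closed_in_lambda_system:
  assumes C: "closed C"
  shows "C \<in> lambda_system UNIV (Pow UNIV) outer_mu"
proof -
  interpret P: sigma_algebra UNIV "Pow UNIV :: 'a set set"
    by (rule sigma_algebra_Pow)
  have subadd: "subadditive (Pow UNIV) outer_mu"
    using outer_measure_space_outer_mu P.countably_subadditive_subadditive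
    by (auto simp: outer_measure_space_def)
  have "outer_mu (A \<inter> C) + outer_mu (A - C) = outer_mu A" for A
  proof (rule antisym)
    have "(A \<inter> C) \<union> (A - C) = A"
      by blast
    then show "outer_mu A \<le> outer_mu (A \<inter> C) + outer_mu (A - C)"
      using subadditiveD[OF subadd, of "A \<inter> C" "A - C"] by auto
    show "outer_mu (A \<inter> C) + outer_mu (A - C) \<le> outer_mu A"
      unfolding outer_mu_def[of A] upper_integral_def[of "indicator A"]
    proof (rule INF_greatest, clarify)
      fix g :: "nat \<Rightarrow> 'a \<Rightarrow> real"
      assume g: "\<forall>i. g i \<in> test_funs" and cover: "\<forall>x\<in>X. indicator A x \<le> (\<Sum>i. ennreal (g i x))"
      have part: "outer_mu (A \<inter> D) \<le> (\<Sum>i. upper_integral (\<lambda>x. ennreal (g i x) * indicator D x))" for D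
      proof -
        have "outer_mu (A \<inter> D) \<le> upper_integral (\<lambda>x. \<Sum>i. ennreal (g i x) * indicator D x)"
          unfolding outer_mu_def
          using cover by (intro upper_integral_mono) (auto simp: indicator_def split: if_splits)
        also have "\<dots> \<le> (\<Sum>i. upper_integral (\<lambda>x. ennreal (g i x) * indicator D x))"
          by (rule upper_integral_suminf)
        finally show ?thesis .
      qed
      have "outer_mu (A \<inter> C) + outer_mu (A - C) \<le>
          (\<Sum>i. upper_integral (\<lambda>x. ennreal (g i x) * indicator C x)) +
          (\<Sum>i. upper_integral (\<lambda>x. ennreal (g i x) * indicator (- C) x))"
        using part[of C] part[of "- C"] by (simp add: Diff_eq add_mono)
      also have "\<dots> = (\<Sum>i. upper_integral (\<lambda>x. ennreal (g i x) * indicator C x) +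
          upper_integral (\<lambda>x. ennreal (g i x) * indicator (- C) x))"
        by (rule suminf_add) auto
      also have "\<dots> \<le> (\<Sum>i. ennreal (L (g i)))"
        using g C by (intro suminf_le upper_integral_split) auto
      finally show "outer_mu (A \<inter> C) + outer_mu (A - C) \<le> (\<Sum>i. ennreal (L (g i)))" .
    qed
  qed
  then show ?thesis
    unfolding P.lambda_system_eq by simp
qed

definition riesz_measure :: "'a measure" where
  "riesz_measure = measure_of UNIV (sets borel) outer_mu"

lemma sets_riesz_measure [measurable_cong]: "sets riesz_measure = sets borel"
  unfolding riesz_measure_def
  by (metis sets.sets_measure_of_eq space_borel)

lemma space_riesz_measure [simp]: "space riesz_measure = UNIV"
  using sets_eq_imp_space_eq[OF sets_riesz_measure] by simp

text \<open>The closed sets generate the Borel sets and meet the Caratheodory criterion, so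
  \<open>outer_mu\<close> is countably additive on the Borel sets.\<close>

lemma emeasure_riesz_measure:
  assumes "A \<in> sets borel"
  shows "emeasure riesz_measure A = outer_mu A"
proof -
  have ms: "measure_space UNIV (lambda_system UNIV (Pow UNIV) outer_mu) outer_mu"
    using sigma_algebra.caratheodory_lemma[OF sigma_algebra_Pow outer_measure_space_outer_mu] .
  have "sigma_sets UNIV (Collect closed) \<subseteq> lambda_system UNIV (Pow UNIV) outer_mu"
    using ms closed_in_lambda_system
    by (intro sigma_algebra.sigma_sets_subset) (auto simp: measure_space_def)
  then have "sets borel \<subseteq> lambda_system UNIV (Pow UNIV) outer_mu"
    by (simp add: borel_eq_closed)
  moreover have "sigma_algebra UNIV (sets borel :: 'a set set)"
    using sets.sigma_algebra_axioms[of borel] by simp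
  ultimately have "measure_space UNIV (sets borel) outer_mu"
    using measure_down[OF ms] by blast
  then show ?thesis
    unfolding riesz_measure_def using assms
    by (intro emeasure_measure_of_sigma) (auto simp: measure_space_def)
qed

text \<open>Compactness reduces a countable cover to a finite one; the part of \<open>F\<close> far away is
  controlled by the second moment.\<close>

lemma L_indicator_closed_le:
  assumes F: "closed F"
  shows "ennreal (L (indicator F)) \<le> outer_mu F"
  unfolding outer_mu_def upper_integral_def
proof (rule INF_greatest, clarify)
  fix g :: "nat \<Rightarrow> 'a \<Rightarrow> real"
  assume g: "\<forall>i. g i \<in> test_funs" and cover: "\<forall>x\<in>X. indicator F x \<le> (\<Sum>i. ennreal (g i x))"
  show "ennreal (L (indicator F)) \<le> (\<Sum>i. ennreal (L (g i)))"
  proof (cases "(\<Sum>i. ennreal (L (g i)))" rule: ennreal_cases)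
    case (real s)
    define c where "c = L (\<lambda>x. x \<bullet> x)"
    have xx: "(\<lambda>x::'a. x \<bullet> x) \<in> poly_bounded X"
      by (intro poly_bounded_polyfun polyfun_inner_self)
    \<comment> \<open>Giving up \<open>e\<close> leaves room for a strict inequality: the open sets
      where a finite partial sum already exceeds \<open>1 - e\<close> cover the compact part of
      \<open>F\<close>.\<close>
    have "(1 - e) * L (indicator F) \<le> s + e * c" if e: "0 < e" for e
    proof -
      \<comment> \<open>Chosen so that \<open>1 \<le> e * (x \<bullet> x)\<close> outside
        \<open>cball 0 R\<close>.\<close>
      define R where "R = 1 / sqrt e"
      have R: "R > 0" "R * R = 1 / e"
        using e by (auto simp: R_def)
      define K where "K = F \<inter> X \<inter> cball 0 R"
      define U where "U = (\<lambda>n. {x. 1 - e < (\<Sum>i<n. g i x)})"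
      have "compact K"
        unfolding K_def using F closed_X by (intro closed_Int_compact closed_Int) auto
      moreover have "open (U n)" for n
        unfolding U_def using g
        by (intro open_Collect_less continuous_on_sum continuous_on_const) (auto simp: test_funs_def)
      moreover have "K \<subseteq> (\<Union>n. U n)"
      proof
        fix x
        assume x: "x \<in> K"
        then have "1 \<le> (\<Sum>i. ennreal (g i x))"
          using cover by (auto simp: K_def indicator_def split: if_splits)
        then have "ennreal (1 - e) < (\<Sum>i. ennreal (g i x))"
          using e by (auto intro!: less_le_trans[OF _ \<open>1 \<le> _\<close>] simp: ennreal_less_one_iff)
        then obtain n where "ennreal (1 - e) < (\<Sum>i<n. ennreal (g i x))"
          unfolding suminf_eq_SUP less_SUP_iff by blast
        also have "(\<Sum>i<n. ennreal (g i x)) = ennreal (\<Sum>i<n. g i x)"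
          using g by (intro sum_ennreal) (auto simp: test_funs_def)
        finally have "1 - e < (\<Sum>i<n. g i x)"
          by (meson ennreal_leI not_le)
        then show "x \<in> (\<Union>n. U n)"
          by (auto simp: U_def)
      qed
      ultimately obtain D where D: "finite D" "K \<subseteq> (\<Union>n\<in>D. U n)"
        by (metis compactE_image)
      \<comment> \<open>Inserting 0 keeps \<open>Max\<close> meaningful when \<open>D\<close> is
        empty, as it may be if \<open>K\<close> is.\<close>
      define n where "n = Max (insert 0 D)"
      have cov: "1 - e \<le> (\<Sum>i<n. g i x)" if x: "x \<in> K" for x
      proof -
        obtain k where k: "k \<in> D" "x \<in> U k"
          using D x by blast
        then have "k \<le> n"
          using D by (simp add: n_def)
        then have "(\<Sum>i<k. g i x) \<le> (\<Sum>i<n. g i x)"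
          using g by (intro sum_mono2) (auto simp: test_funs_def)
        then show ?thesis
          using k by (simp add: U_def)
      qed
      have gE: "g i \<in> poly_bounded X" for i
        using g by (simp add: test_funs_def)
      have "(1 - e) * L (indicator F) = L (\<lambda>x. (1 - e) * indicator F x)"
        by (simp add: L_scale poly_bounded_indicator)
      also have "\<dots> \<le> L (\<lambda>x. (\<Sum>i<n. g i x) + e * (x \<bullet> x))"
      proof (intro L_mono poly_bounded_add poly_bounded_sum poly_bounded_cmult poly_bounded_indicator gE xx)
        fix x
        assume x: "x \<in> X"
        have s0: "0 \<le> (\<Sum>i<n. g i x)"
          using g by (intro sum_nonneg) (auto simp: test_funs_def)
        have e0: "0 \<le> e * (x \<bullet> x)"
          using e by simp
        show "(1 - e) * indicator F x \<le> (\<Sum>i<n. g i x) + e * (x \<bullet> x)"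
        proof (cases "x \<in> F \<and> x \<notin> cball 0 R")
          case True
          then have "R * R \<le> norm x * norm x"
            using R by (intro mult_mono) auto
          then have "e * (R * R) \<le> e * (norm x * norm x)"
            using e by (intro mult_left_mono) auto
          moreover have "norm x * norm x = x \<bullet> x" "e * (R * R) = 1"
            using R(2) e by (simp_all add: dot_square_norm power2_eq_square)
          ultimately have "1 \<le> e * (x \<bullet> x)"
            by simp
          then show ?thesis
            using True s0 e by simp
        next
          case False
          then show ?thesis
            using cov[of x] x s0 e0 by (cases "x \<in> F") (auto simp: K_def)
        qed
      qed simp
      also have "\<dots> = (\<Sum>i<n. L (g i)) + e * c"
        by (subst L_add) (auto intro!: poly_bounded_sum poly_bounded_cmult gE xx simp: L_sum gE L_scale xx c_def)
      also have "(\<Sum>i<n. L (g i)) \<le> s"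
      proof -
        have "ennreal (\<Sum>i<n. L (g i)) = (\<Sum>i<n. ennreal (L (g i)))"
          using g by (subst sum_ennreal) (auto intro: test_fun_L_nonneg)
        also have "\<dots> \<le> ennreal s"
          unfolding real(2)[symmetric] by (intro sum_le_suminf) auto
        finally show ?thesis
          using real(1) by simp
      qed
      finally show ?thesis
        by simp
    qed
    then have "(1 - 1 / real (Suc n)) * L (indicator F) \<le> s + 1 / real (Suc n) * c" for n
      by (metis of_nat_0_less_iff zero_less_Suc zero_less_divide_1_iff)
    moreover have "(\<lambda>n. (1 - 1 / real (Suc n)) * L (indicator F)) \<longlonglongrightarrow> (1 - 0) * L (indicator F)"
      by (intro tendsto_intros LIMSEQ_Suc[OF lim_1_over_n])
    moreover have "(\<lambda>n. s + 1 / real (Suc n) * c) \<longlonglongrightarrow> s + 0 * c"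
      by (intro tendsto_intros LIMSEQ_Suc[OF lim_1_over_n])
    ultimately have "(1 - 0) * L (indicator F) \<le> s + 0 * c"
      by (intro LIMSEQ_le[of _ _ _ "s + 0 * c"]) auto
    then show ?thesis
      using real by (simp add: ennreal_leI)
  qed simp
qed

text \<open>The constant 1 is a test function, which gives one inequality, and the indicator of the
  closed set \<open>UNIV\<close>, which gives the other.\<close>

lemma emeasure_riesz_UNIV: "emeasure riesz_measure UNIV = ennreal (L (\<lambda>x. 1))"
proof (rule antisym)
  have "(\<lambda>x. 1) \<in> test_funs"
    by (simp add: test_funs_def poly_bounded_const)
  from upper_integral_test_fun[OF this]
  show "emeasure riesz_measure UNIV \<le> ennreal (L (\<lambda>x. 1))"
    by (simp add: emeasure_riesz_measure outer_mu_def indicator_def)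
  show "ennreal (L (\<lambda>x. 1)) \<le> emeasure riesz_measure UNIV"
    using L_indicator_closed_le[of UNIV] by (simp add: emeasure_riesz_measure indicator_def)
qed

lemma finite_measure_riesz: "finite_measure riesz_measure"
  by (rule finite_measureI) (simp add: emeasure_riesz_UNIV)

text \<open>The zero function already covers this indicator on \<open>X\<close>.\<close>

lemma emeasure_riesz_off_X: "emeasure riesz_measure (UNIV - X) = 0"
proof -
  have "upper_integral (indicator (UNIV - X)) \<le> upper_integral (\<lambda>x. ennreal 0)"
    by (rule upper_integral_mono) simp
  also have "\<dots> \<le> ennreal (L (\<lambda>x. 0))"
    by (rule upper_integral_test_fun) (simp add: test_funs_def poly_bounded_const)
  finally show ?thesis
    using closed_X by (simp add: emeasure_riesz_measure outer_mu_def L_zero borel_closed)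
qed

text \<open>Layer cake at scale \<open>1 / K\<close>: the indicators of the closed sets
  \<open>F k\<close> add up to the floor of \<open>K * f\<close>, which is within 1 of
  \<open>K * f\<close>. On each of these indicators the functional is at most the measure, so the
  error is \<open>L 1 / K\<close>.\<close>

lemma L_le_integral:
  assumes f: "continuous_on UNIV f" and f01: "\<And>x. 0 \<le> f x" "\<And>x. f x \<le> 1"
  shows "L f \<le> integral\<^sup>L riesz_measure f"
proof -
  interpret finite_measure riesz_measure
    by (rule finite_measure_riesz)
  have fE: "f \<in> poly_bounded X"
    using f01 by (intro poly_bounded_bounded[of _ _ 1]) (simp add: abs_le_iff order_trans[of _ 0])
  have [measurable]: "f \<in> borel_measurable borel"
    using f by (rule borel_measurable_continuous_onI)
  have fint: "integrable riesz_measure f"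
    using f01 by (intro integrable_const_bound[of _ 1]) (auto simp: abs_le_iff)
  have "L f \<le> integral\<^sup>L riesz_measure f + 1 / real (Suc n) * L (\<lambda>x. 1)" for n
  proof -
    define K where "K = Suc n"
    define F where "F = (\<lambda>k. {x. real k \<le> real K * f x})"
    have F: "closed (F k)" for k
      unfolding F_def by (intro closed_Collect_le continuous_intros f)
    have step: "(\<Sum>k=1..K. indicator (F k) x :: real) = of_int \<lfloor>real K * f x\<rfloor>" for x
    proof -
      have "(\<Sum>k=1..K. indicator (F k) x :: real) = real (card {k\<in>{1..K}. real k \<le> real K * f x})"
        by (simp add: indicator_def F_def sum.If_cases Int_def)
      also have "{k\<in>{1..K}. real k \<le> real K * f x} = {1..nat \<lfloor>real K * f x\<rfloor>}"
      proof -
        have "real K * f x \<le> real K"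
          using f01(2)[of x] by (simp add: mult_left_le)
        moreover have "k \<le> nat \<lfloor>real K * f x\<rfloor> \<longleftrightarrow> real k \<le> real K * f x" for k
          using f01(1)[of x] by (simp add: le_nat_iff le_floor_iff)
        moreover have "k \<le> K" if "real k \<le> real K * f x" for k
          using order_trans[OF that \<open>real K * f x \<le> real K\<close>] by simp
        ultimately show ?thesis
          unfolding set_eq_iff mem_Collect_eq atLeastAtMost_iff by blast
      qed
      also have "real (card {1..nat \<lfloor>real K * f x\<rfloor>}) = of_int \<lfloor>real K * f x\<rfloor>"
        using f01(1)[of x] by simp
      finally show ?thesis .
    qed
    have "real K * L f = L (\<lambda>x. real K * f x)"
      by (simp add: L_scale fE)
    also have "\<dots> \<le> L (\<lambda>x. 1 + (\<Sum>k=1..K. indicator (F k) x))"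
    proof (intro L_mono poly_bounded_add poly_bounded_sum poly_bounded_cmult poly_bounded_indicator
        poly_bounded_const fE)
      show "real K * f x \<le> 1 + (\<Sum>k=1..K. indicator (F k) x)" for x
        unfolding step by linarith
    qed simp
    also have "\<dots> = L (\<lambda>x. 1) + (\<Sum>k=1..K. L (indicator (F k)))"
      by (subst L_add) (auto intro!: poly_bounded_sum poly_bounded_indicator poly_bounded_const
          simp: L_sum poly_bounded_indicator)
    also have "(\<Sum>k=1..K. L (indicator (F k))) \<le> (\<Sum>k=1..K. measure riesz_measure (F k))"
    proof (rule sum_mono)
      fix k
      have "ennreal (L (indicator (F k))) \<le> ennreal (measure riesz_measure (F k))"
        using L_indicator_closed_le[OF F] F[of k]
        by (simp add: emeasure_riesz_measure emeasure_eq_measure[symmetric] borel_closed)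
      then show "L (indicator (F k)) \<le> measure riesz_measure (F k)"
        by simp
    qed
    also have "\<dots> = integral\<^sup>L riesz_measure (\<lambda>x. \<Sum>k=1..K. indicator (F k) x)"
      using F by (subst Bochner_Integration.integral_sum)
        (auto simp: sets_riesz_measure borel_closed emeasure_eq_measure)
    also have "\<dots> \<le> integral\<^sup>L riesz_measure (\<lambda>x. real K * f x)"
    proof (rule integral_mono)
      show "integrable riesz_measure (\<lambda>x. \<Sum>k=1..K. indicator (F k) x :: real)"
        using F by (auto simp: sets_riesz_measure borel_closed emeasure_eq_measure)
      show "(\<Sum>k=1..K. indicator (F k) x) \<le> real K * f x" for x
        unfolding step by simp
    qed (use fint in auto)
    also have "\<dots> = real K * integral\<^sup>L riesz_measure f"
      by simp
    finally show ?thesis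
      by (simp add: K_def field_simps)
  qed
  moreover have "(\<lambda>n. integral\<^sup>L riesz_measure f + 1 / real (Suc n) * L (\<lambda>x. 1)) \<longlonglongrightarrow>
      integral\<^sup>L riesz_measure f + 0 * L (\<lambda>x. 1)"
    by (intro tendsto_intros LIMSEQ_Suc[OF lim_1_over_n])
  ultimately have "L f \<le> integral\<^sup>L riesz_measure f + 0 * L (\<lambda>x. 1)"
    by (intro LIMSEQ_le_const) auto
  then show ?thesis
    by simp
qed

text \<open>After scaling into the unit interval, the one-sided bound applied to \<open>h\<close>
  and to \<open>1 - h\<close> gives equality, because functional and integral agree on the constant
  1.\<close>

lemma integral_eq_L_bounded:
  assumes f: "continuous_on UNIV f" and f0: "\<And>x. 0 \<le> f x" and fB: "\<And>x. f x \<le> B"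
  shows "has_bochner_integral riesz_measure f (L f)"
proof -
  interpret finite_measure riesz_measure
    by (rule finite_measure_riesz)
  define b where "b = max B 1"
  have b: "b > 0" "\<And>x. f x \<le> b"
    using fB by (auto simp: b_def le_max_iff_disj)
  define h where "h = (\<lambda>x. 1 / b * f x)"
  have h: "continuous_on UNIV h" "\<And>x. 0 \<le> h x" "\<And>x. h x \<le> 1"
    using f f0 b unfolding h_def by (auto intro!: continuous_intros)
  have [measurable]: "f \<in> borel_measurable borel"
    using f by (rule borel_measurable_continuous_onI)
  have fE: "f \<in> poly_bounded X"
    using f0 b by (intro poly_bounded_bounded[of _ _ b]) (simp add: abs_le_iff order_trans[of _ 0])
  have fint: "integrable riesz_measure f"
    using f0 b(2) by (intro integrable_const_bound[of _ b]) (auto simp: abs_le_iff)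
  have hE: "h \<in> poly_bounded X"
    unfolding h_def by (intro poly_bounded_cmult fE)
  have "L (\<lambda>x. 1 - h x) \<le> integral\<^sup>L riesz_measure (\<lambda>x. 1 - h x)"
    using h by (intro L_le_integral) (auto intro!: continuous_intros)
  also have "\<dots> = L (\<lambda>x. 1) - integral\<^sup>L riesz_measure h"
  proof -
    have "0 \<le> L (\<lambda>x. 1)"
      by (intro nonneg poly_bounded_const) auto
    then have "measure riesz_measure UNIV = L (\<lambda>x. 1)"
      using emeasure_riesz_UNIV by (simp add: measure_def)
    then show ?thesis
      using fint by (subst Bochner_Integration.integral_diff) (auto simp: h_def)
  qed
  finally have "integral\<^sup>L riesz_measure h \<le> L h"
    by (simp add: L_diff poly_bounded_const hE)
  then have "integral\<^sup>L riesz_measure h = L h"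
    using L_le_integral[OF h] by simp
  then have "integral\<^sup>L riesz_measure f = L f"
    using b unfolding h_def L_scale[OF fE] by simp
  then show ?thesis
    using fint by (simp add: has_bochner_integral_iff)
qed

text \<open>Truncation at \<open>n\<close> loses at most \<open>f * f / n\<close>, and
  \<open>f * f\<close> is again in the domain of \<open>L\<close>. So \<open>L\<close> of the
  truncations tends to \<open>L f\<close>, while their integrals tend to that of \<open>f\<close> by
  monotone convergence.\<close>

lemma integral_eq_L_nonneg:
  assumes f: "continuous_on UNIV f" and f0: "\<And>x. 0 \<le> f x" and fE: "f \<in> poly_bounded X"
  shows "has_bochner_integral riesz_measure f (L f)"
proof -
  define h where "h = (\<lambda>(n::nat) x. min (f x) (real n))"
  have h: "continuous_on UNIV (h n)" "\<And>x. 0 \<le> h n x" "\<And>x. h n x \<le> real n" for n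
    unfolding h_def using f0 by (auto intro!: continuous_intros f)
  have hE: "h n \<in> poly_bounded X" for n
    using f0 by (intro poly_bounded_mono[OF fE]) (auto simp: h_def)
  have [measurable]: "f \<in> borel_measurable borel" "h n \<in> borel_measurable borel" for n
    using f h(1) by (auto intro: borel_measurable_continuous_onI)
  have hL: "0 \<le> L (h n)" for n
    using h by (intro nonneg hE) auto
  have nn: "(\<integral>\<^sup>+x. ennreal (h n x) \<partial>riesz_measure) = ennreal (L (h n))" for n
    using integral_eq_L_bounded[OF h] h(2)
    by (subst nn_integral_eq_integral) (auto simp: has_bochner_integral_iff)
  have "(\<lambda>n. \<integral>\<^sup>+x. ennreal (h n x) \<partial>riesz_measure) \<longlonglongrightarrow> (\<integral>\<^sup>+x. ennreal (f x) \<partial>riesz_measure)"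
  proof (rule nn_integral_LIMSEQ)
    show "incseq (\<lambda>n x. ennreal (h n x))"
      by (auto simp: incseq_def le_fun_def h_def intro!: ennreal_leI)
    show "(\<lambda>n. ennreal (h n x)) \<longlonglongrightarrow> ennreal (f x)" for x
    proof (rule tendsto_eventually)
      obtain N where "f x \<le> real N"
        using real_arch_simple by blast
      then have "h n x = f x" if "n \<ge> N" for n
        using that by (simp add: h_def min_def)
      then show "\<forall>\<^sub>F n in sequentially. ennreal (h n x) = ennreal (f x)"
        unfolding eventually_sequentially by (intro exI[of _ N]) simp
    qed
  qed simp
  moreover have "(\<lambda>n. ennreal (L (h n))) \<longlonglongrightarrow> ennreal (L f)"
  proof (intro tendsto_ennrealI)
    have upper: "L f - L (h (Suc n)) \<le> 1 / real (Suc n) * L (\<lambda>x. f x * f x)" for n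
    proof -
      have "L (\<lambda>x. f x - h (Suc n) x) \<le> L (\<lambda>x. 1 / real (Suc n) * (f x * f x))"
      proof (intro L_mono poly_bounded_diff poly_bounded_cmult poly_bounded_mult fE hE)
        fix x
        show "f x - h (Suc n) x \<le> 1 / real (Suc n) * (f x * f x)"
        proof (cases "f x \<le> real (Suc n)")
          case True
          then show ?thesis
            using f0[of x] by (simp add: h_def)
        next
          case False
          then have "f x * real (Suc n) \<le> f x * f x"
            using f0[of x] by (intro mult_left_mono) auto
          then have "f x \<le> 1 / real (Suc n) * (f x * f x)"
            by (simp add: field_simps)
          then show ?thesis
            using h(2)[of "Suc n" x] by linarith
        qed
      qed
      then show ?thesis
        by (simp only: L_diff[OF fE hE] L_scale[OF poly_bounded_mult[OF fE fE]])
    qed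
    have lower: "0 \<le> L f - L (h (Suc n))" for n
      using L_mono[OF hE fE, of "Suc n"] by (simp add: h_def)
    have lim: "(\<lambda>n. 1 / real (Suc n) * L (\<lambda>x. f x * f x)) \<longlonglongrightarrow> 0"
      by (rule tendsto_mult_left_zero) (rule LIMSEQ_Suc[OF lim_1_over_n])
    have "(\<lambda>n. L f - L (h (Suc n))) \<longlonglongrightarrow> 0"
    proof (rule tendsto_sandwich)
      show "\<forall>\<^sub>F n in sequentially. 0 \<le> L f - L (h (Suc n))"
        by (intro always_eventually allI lower)
      show "\<forall>\<^sub>F n in sequentially. L f - L (h (Suc n)) \<le> 1 / real (Suc n) * L (\<lambda>x. f x * f x)"
        by (intro always_eventually allI upper)
    qed (rule tendsto_const lim)+
    then have "(\<lambda>n. L f - (L f - L (h (Suc n)))) \<longlonglongrightarrow> L f - 0"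
      by (intro tendsto_intros)
    then show "(\<lambda>n. L (h n)) \<longlonglongrightarrow> L f"
      by (auto intro: LIMSEQ_imp_Suc)
  qed
  ultimately have "(\<integral>\<^sup>+x. ennreal (f x) \<partial>riesz_measure) = ennreal (L f)"
    using LIMSEQ_unique by (simp add: nn)
  then show ?thesis
    using f0 by (intro has_bochner_integral_nn_integral nonneg fE) auto
qed

theorem riesz_representation:
  assumes f: "continuous_on UNIV f" and fE: "f \<in> poly_bounded X"
  shows "has_bochner_integral riesz_measure f (L f)"
proof -
  have E: "(\<lambda>x. max (f x) 0) \<in> poly_bounded X" "(\<lambda>x. max (- f x) 0) \<in> poly_bounded X"
    by (auto intro!: poly_bounded_mono[OF fE])
  have "has_bochner_integral riesz_measure (\<lambda>x. max (f x) 0 - max (- f x) 0)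
      (L (\<lambda>x. max (f x) 0) - L (\<lambda>x. max (- f x) 0))"
    using E by (intro has_bochner_integral_diff integral_eq_L_nonneg) (auto intro!: continuous_intros f)
  also have "L (\<lambda>x. max (f x) 0) - L (\<lambda>x. max (- f x) 0) = L (\<lambda>x. max (f x) 0 - max (- f x) 0)"
    using L_diff[OF E] by simp
  also have "(\<lambda>x. max (f x) 0 - max (- f x) 0) = f"
    by (auto simp: max_def)
  finally show ?thesis .
qed

lemma admissible_riesz_measure: "admissible X riesz_measure"
  unfolding admissible_def
proof (intro conjI ballI)
  fix p :: "'a \<Rightarrow> real"
  assume "p \<in> polyfun"
  then show "integrable riesz_measure p"
    using riesz_representation continuous_on_polyfun poly_bounded_polyfun has_bochner_integral_iff by blast
qed (rule sets_riesz_measure emeasure_riesz_off_X)+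

end


subsection \<open>Uniqueness of measures with equal Fantappie transforms\<close>

text \<open>The closed sets are a generator stable under intersection, and their indicators are
  limits of the continuous functions \<open>max 0 (1 - n * infdist x C)\<close>.\<close>

lemma measure_eqI_continuous:
  fixes M N :: "'b::euclidean_space measure"
  assumes fin: "finite_measure M" "finite_measure N"
    and sets [measurable_cong]: "sets M = sets borel" "sets N = sets borel"
    and eq: "\<And>f :: 'b \<Rightarrow> real. continuous_on UNIV f \<Longrightarrow> (\<And>x. 0 \<le> f x) \<Longrightarrow> (\<And>x. f x \<le> 1) \<Longrightarrow>
      integral\<^sup>L M f = integral\<^sup>L N f"
  shows "M = N"
proof -
  interpret M: finite_measure M by fact
  interpret N: finite_measure N by fact
  have space: "space M = UNIV" "space N = UNIV"
    using sets by (auto dest: sets_eq_imp_space_eq)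
  have closed_eq: "emeasure M C = emeasure N C" if C: "closed C" for C
  proof (cases "C = {}")
    case False
    define h where "h = (\<lambda>(n::nat) x. max 0 (1 - real n * infdist x C))"
    have h01: "0 \<le> h n x" "h n x \<le> 1" for n x
      by (auto simp: h_def infdist_nonneg)
    have hcont: "continuous_on UNIV (h n)" for n
      unfolding h_def by (intro continuous_intros)
    have [measurable]: "h n \<in> borel_measurable borel" for n
      using hcont by (rule borel_measurable_continuous_onI)
    have [measurable]: "C \<in> sets borel"
      using C by (rule borel_closed)
    have lim: "(\<lambda>n. h n x) \<longlonglongrightarrow> indicator C x" for x
    proof (cases "x \<in> C")
      case True
      then show ?thesis
        by (simp add: h_def)
    next
      case off: False
      then have pos: "infdist x C > 0"
        using C False infdist_nonneg[of x C] in_closed_iff_infdist_zero[of C x] by fastforce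
      obtain n0 where n0: "1 < real n0 * infdist x C"
        using reals_Archimedean3[OF pos] by blast
      have "h n x = 0" if "n \<ge> n0" for n
      proof -
        have "real n0 * infdist x C \<le> real n * infdist x C"
          using that pos by (intro mult_right_mono) auto
        then show ?thesis
          using n0 by (simp add: h_def)
      qed
      then show ?thesis
        using off by (intro tendsto_eventually) (auto simp: eventually_sequentially)
    qed
    have "(\<lambda>n. integral\<^sup>L M (h n)) \<longlonglongrightarrow> integral\<^sup>L M (indicator C)"
      by (rule integral_dominated_convergence[where w = "\<lambda>_. 1"]) (use lim h01 in auto)
    moreover have "(\<lambda>n. integral\<^sup>L N (h n)) \<longlonglongrightarrow> integral\<^sup>L N (indicator C)"
      by (rule integral_dominated_convergence[where w = "\<lambda>_. 1"]) (use lim h01 in auto)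
    moreover have "integral\<^sup>L M (h n) = integral\<^sup>L N (h n)" for n
      by (intro eq hcont h01)
    ultimately have "integral\<^sup>L M (indicator C) = (integral\<^sup>L N (indicator C) :: real)"
      by (auto intro: LIMSEQ_unique)
    then show ?thesis
      by (simp add: M.emeasure_eq_measure N.emeasure_eq_measure space)
  qed simp
  show ?thesis
  proof (rule measure_eqI_generator_eq[where E = "Collect closed" and \<Omega> = UNIV and A = "\<lambda>_. UNIV"])
    show "Int_stable (Collect closed :: 'b set set)"
      by (auto simp: Int_stable_def)
    show "sets M = sigma_sets UNIV (Collect closed)" "sets N = sigma_sets UNIV (Collect closed)"
      using sets by (simp_all add: borel_eq_closed)
    show "emeasure M UNIV \<noteq> \<infinity>"
      by (simp add: M.emeasure_eq_measure)
  qed (auto simp: closed_eq)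
qed

text \<open>Polynomials are uniformly dense in the continuous functions on \<open>K\<close>, and
  neither image puts mass off \<open>K\<close>. Applied once with the unit interval and once with a
  box containing the values of exponentials.\<close>

lemma distr_eq_of_polynomials:
  fixes \<phi> :: "'a::euclidean_space \<Rightarrow> 'b::euclidean_space"
  assumes fin: "finite_measure M" "finite_measure N"
    and sets [measurable_cong]: "sets M = sets borel" "sets N = sets borel"
    and \<phi> [measurable]: "\<phi> \<in> borel_measurable borel"
    and K: "compact K" "AE x in M. \<phi> x \<in> K" "AE x in N. \<phi> x \<in> K"
    and eq: "\<And>p. real_polynomial_function p \<Longrightarrow> (\<integral>x. p (\<phi> x) \<partial>M) = (\<integral>x. p (\<phi> x) \<partial>N)"
  shows "distr M borel \<phi> = distr N borel \<phi>"
proof (rule measure_eqI_continuous)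
  show "finite_measure (distr M borel \<phi>)" "finite_measure (distr N borel \<phi>)"
    by (intro finite_measure.finite_measure_distr fin; measurable)+
  fix f :: "'b \<Rightarrow> real"
  assume f: "continuous_on UNIV f"
  then have [measurable]: "f \<in> borel_measurable borel"
    by (rule borel_measurable_continuous_onI)
  define c where "c = measure M (space M) + measure N (space N)"
  have approx: "\<bar>(\<integral>x. f (\<phi> x) \<partial>L) - (\<integral>x. g (\<phi> x) \<partial>L)\<bar> \<le> e * measure L (space L)"
    if L: "finite_measure L" "sets L = sets borel" "AE x in L. \<phi> x \<in> K"
      and g: "continuous_on UNIV g" "\<And>y. y \<in> K \<Longrightarrow> \<bar>f y - g y\<bar> \<le> e" for L g e
  proof -
    interpret finite_measure L by fact
    note L(2) [measurable_cong]
    have int: "integrable L (\<lambda>x. h (\<phi> x))" if h: "continuous_on UNIV h" for h :: "'b \<Rightarrow> real"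
    proof -
      have [measurable]: "h \<in> borel_measurable borel"
        using h by (rule borel_measurable_continuous_onI)
      have "compact (h ` K)"
        using K(1) h by (intro compact_continuous_image continuous_on_subset[OF h]) auto
      then obtain b where "\<forall>y\<in>h ` K. norm y \<le> b"
        using compact_imp_bounded bounded_iff by metis
      then show ?thesis
        using L(3) by (intro integrable_const_bound[of _ b]) auto
    qed
    have fg: "integrable L (\<lambda>x. f (\<phi> x) - g (\<phi> x))"
      by (intro Bochner_Integration.integrable_diff int f g)
    have "\<bar>(\<integral>x. f (\<phi> x) \<partial>L) - (\<integral>x. g (\<phi> x) \<partial>L)\<bar> = \<bar>\<integral>x. f (\<phi> x) - g (\<phi> x) \<partial>L\<bar>"
      by (simp add: int f g)
    also have "\<dots> \<le> (\<integral>x. \<bar>f (\<phi> x) - g (\<phi> x)\<bar> \<partial>L)"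
      by (rule integral_abs_bound)
    also have "\<dots> \<le> (\<integral>x. e \<partial>L)"
      using fg L(3) g(2) by (intro integral_mono_AE) auto
    finally show ?thesis
      by (simp add: mult.commute)
  qed
  have small: "\<bar>(\<integral>x. f (\<phi> x) \<partial>M) - (\<integral>x. f (\<phi> x) \<partial>N)\<bar> \<le> e * c" if e: "0 < e" for e
  proof -
    obtain g where g: "real_polynomial_function g" "\<And>y. y \<in> K \<Longrightarrow> \<bar>f y - g y\<bar> < e"
      using Stone_Weierstrass_real_polynomial_function[OF K(1) continuous_on_subset[OF f] e] by blast
    have gc: "continuous_on UNIV g"
      using g(1) continuous_on_polymonial_function real_polynomial_function_eq by blast
    have ge: "\<bar>f y - g y\<bar> \<le> e" if "y \<in> K" for y
      using g(2)[OF that] by simp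
    show ?thesis
      using approx[OF fin(1) sets(1) K(2) gc ge] approx[OF fin(2) sets(2) K(3) gc ge] eq[OF g(1)]
      by (simp add: c_def algebra_simps)
  qed
  have "\<bar>(\<integral>x. f (\<phi> x) \<partial>M) - (\<integral>x. f (\<phi> x) \<partial>N)\<bar> \<le> 0"
  proof (rule field_le_epsilon)
    fix e :: real
    assume e: "0 < e"
    have c: "0 \<le> c"
      by (simp add: c_def)
    \<comment> \<open>The added 1 allows for \<open>c = 0\<close>, that is, for two null
      measures.\<close>
    have "e / (c + 1) * c \<le> e"
      using e c by (simp add: field_simps)
    then show "\<bar>(\<integral>x. f (\<phi> x) \<partial>M) - (\<integral>x. f (\<phi> x) \<partial>N)\<bar> \<le> 0 + e"
      using small[of "e / (c + 1)"] e c by simp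
  qed
  then show "integral\<^sup>L (distr M borel \<phi>) f = integral\<^sup>L (distr N borel \<phi>) f"
    by (simp add: integral_distr)
qed simp_all

text \<open>With \<open>u = 1 / (1 + s)\<close>, the transform near \<open>t = 1\<close> is the integral of \<open>u / (1 - r * u)\<close> for
  small \<open>r = 1 - t\<close>. Divided differences at \<open>r = 0\<close> produce all moments of \<open>u\<close>, which
  determine the distribution of \<open>u\<close> because \<open>u\<close> is bounded.\<close>

lemma Laplace_eq_of_Stieltjes_eq:
  fixes s :: "'a::euclidean_space \<Rightarrow> real"
  assumes fin: "finite_measure M" "finite_measure N"
    and sets [measurable_cong]: "sets M = sets borel" "sets N = sets borel"
    and s [measurable]: "s \<in> borel_measurable borel" and s0: "\<And>x. 0 \<le> s x"
    and mass: "measure M UNIV = measure N UNIV"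
    and d: "0 < d" and eq: "\<And>t. \<bar>t - 1\<bar> < d \<Longrightarrow> (\<integral>x. 1 / (t + s x) \<partial>M) = (\<integral>x. 1 / (t + s x) \<partial>N)"
  shows "(\<integral>x. exp (- (l * s x)) \<partial>M) = (\<integral>x. exp (- (l * s x)) \<partial>N)"
proof -
  interpret M: finite_measure M by fact
  interpret N: finite_measure N by fact
  have space: "space M = UNIV" "space N = UNIV"
    using sets by (auto dest: sets_eq_imp_space_eq)
  define u where "u = (\<lambda>x. 1 / (1 + s x))"
  have [measurable]: "u \<in> borel_measurable borel"
    unfolding u_def by measurable
  have u01: "0 < u x" "u x \<le> 1" for x
    using s0[of x] by (auto simp: u_def)
  \<comment> \<open>The cap 1/2 keeps \<open>1 - r * u x\<close> at least 1/2, so that all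
    integrands below are bounded by 2.\<close>
  define \<delta> where "\<delta> = min d (1/2)"
  have \<delta>: "0 < \<delta>" "\<delta> \<le> 1/2" "\<delta> \<le> d"
    using d by (auto simp: \<delta>_def)
  have den: "1/2 \<le> 1 - r * u x" if "\<bar>r\<bar> < \<delta>" for r x
  proof -
    have "r * u x \<le> \<bar>r\<bar> * u x"
      using u01(1)[of x] by (intro mult_right_mono) auto
    also have "\<dots> \<le> 1/2 * 1"
      using that \<delta> u01[of x] by (intro mult_mono) auto
    finally show ?thesis
      by simp
  qed
  have bound: "\<bar>u x ^ k / (1 - r * u x)\<bar> \<le> 2" if "\<bar>r\<bar> < \<delta>" for r x k
  proof -
    have "\<bar>u x ^ k / (1 - r * u x)\<bar> = u x ^ k / (1 - r * u x)"
      using den[OF that, of x] u01(1)[of x] by simp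
    also have "\<dots> \<le> 1 / (1/2)"
      using den[OF that, of x] u01[of x] by (intro frac_le power_le_one) auto
    finally show ?thesis
      by simp
  qed
  have int: "integrable L (\<lambda>x. u x ^ k / (1 - r * u x))"
    if "finite_measure L" "sets L = sets borel" "\<bar>r\<bar> < \<delta>" for L k r
  proof -
    interpret finite_measure L by fact
    note that(2) [measurable_cong]
    show ?thesis
      using bound[OF that(3)] by (intro integrable_const_bound[of _ 2]) auto
  qed
  \<comment> \<open>The points \<open>\<delta> / (n + 2)\<close> tend to 0, are nonzero and stay
    strictly inside the radius \<open>\<delta>\<close>; with \<open>n + 1\<close> the first would
    lie on the boundary.\<close>
  have conv: "(\<lambda>n. \<integral>x. u x ^ k / (1 - \<delta> / real (n + 2) * u x) \<partial>L) \<longlonglongrightarrow> (\<integral>x. u x ^ k \<partial>L)"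
    if "finite_measure L" "sets L = sets borel" for L k
  proof -
    interpret finite_measure L by fact
    note that(2) [measurable_cong]
    show ?thesis
    proof (rule integral_dominated_convergence[where w = "\<lambda>_. 2"])
      show "AE x in L. (\<lambda>n. u x ^ k / (1 - \<delta> / real (n + 2) * u x)) \<longlonglongrightarrow> u x ^ k"
      proof (rule AE_I2)
        fix x
        have "(\<lambda>n. \<delta> / real (n + 2)) \<longlonglongrightarrow> 0"
          using LIMSEQ_ignore_initial_segment[OF lim_const_over_n[of \<delta>], of 2] by simp
        then have "(\<lambda>n. u x ^ k / (1 - \<delta> / real (n + 2) * u x)) \<longlonglongrightarrow> u x ^ k / (1 - 0 * u x)"
          by (intro tendsto_intros) auto
        then show "(\<lambda>n. u x ^ k / (1 - \<delta> / real (n + 2) * u x)) \<longlonglongrightarrow> u x ^ k"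
          by simp
      qed
      have "\<bar>\<delta> / real (n + 2)\<bar> < \<delta>" for n
        using \<delta>(1) by (simp add: field_simps add_pos_nonneg)
      then show "AE x in L. norm (u x ^ k / (1 - \<delta> / real (n + 2) * u x)) \<le> 2" for n
        unfolding real_norm_def by (intro AE_I2 bound)
    qed auto
  qed
  have res: "(\<integral>x. u x ^ Suc k / (1 - r * u x) \<partial>M) = (\<integral>x. u x ^ Suc k / (1 - r * u x) \<partial>N)"
    if "\<bar>r\<bar> < \<delta>" for r k
    using that
  proof (induction k arbitrary: r)
    case 0
    \<comment> \<open>The hypothesis is used at \<open>t = 1 - r\<close>, by the factorization
      \<open>1 - r + s = (1 + s) * (1 - r * u)\<close>.\<close>
    have "u x ^ Suc 0 / (1 - r * u x) = 1 / (1 - r + s x)" for x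
    proof -
      have "1 - r * u x > 0"
        using den[OF 0, of x] by linarith
      moreover have "1 + s x > 0"
        using s0[of x] by linarith
      moreover have "1 - r + s x = (1 + s x) * (1 - r * u x)"
        using \<open>1 + s x > 0\<close> by (simp add: u_def field_simps)
      ultimately show ?thesis
        by (simp add: u_def)
    qed
    then show ?case
      using eq[of "1 - r"] 0 \<delta> by simp
  next
    case (Suc k)
    have nz: "(\<integral>x. u x ^ Suc (Suc k) / (1 - r * u x) \<partial>M) = (\<integral>x. u x ^ Suc (Suc k) / (1 - r * u x) \<partial>N)"
      if r: "\<bar>r\<bar> < \<delta>" "r \<noteq> 0" for r
    proof -
      \<comment> \<open>The divided difference at 0 raises the exponent by one, as
        \<open>(1 / (1 - r * u) - 1) / r = u / (1 - r * u)\<close>.\<close>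
      have "u x ^ Suc (Suc k) / (1 - r * u x) =
          (u x ^ Suc k / (1 - r * u x) - u x ^ Suc k / (1 - 0 * u x)) / r" for x
        using den[OF r(1), of x] r(2) by (simp add: field_simps)
      moreover have "integrable M (\<lambda>x. u x ^ Suc k)" "integrable N (\<lambda>x. u x ^ Suc k)"
        using int[OF fin(1) sets(1), of 0 "Suc k"] int[OF fin(2) sets(2), of 0 "Suc k"] \<delta>(1) by simp_all
      ultimately show ?thesis
        using int[OF fin(1) sets(1) r(1)] int[OF fin(2) sets(2) r(1)] \<delta>(1) Suc.IH[OF r(1)] Suc.IH[of 0]
        by (simp del: power_Suc)
    qed
    show ?case
    proof (cases "r = 0")
      case True
      \<comment> \<open>Division by \<open>r\<close> is impossible here, so the value at 0 is
        reached as a limit of values at nonzero points.\<close>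
      have small: "\<bar>\<delta> / real (n + 2)\<bar> < \<delta>" "\<delta> / real (n + 2) \<noteq> 0" for n
        using \<delta>(1) by (auto simp: field_simps add_pos_nonneg)
      have "(\<integral>x. u x ^ Suc (Suc k) \<partial>M) = (\<integral>x. u x ^ Suc (Suc k) \<partial>N)"
        using conv[OF fin(1) sets(1), of "Suc (Suc k)"] conv[OF fin(2) sets(2), of "Suc (Suc k)"]
        unfolding nz[OF small] by (rule LIMSEQ_unique)
      then show ?thesis
        using True by simp
    qed (use nz Suc.prems in blast)
  qed
  have moments: "(\<integral>x. u x ^ k \<partial>M) = (\<integral>x. u x ^ k \<partial>N)" for k
  proof (cases k)
    \<comment> \<open>\<open>res\<close> starts at the first power; the zeroth moment is the
      hypothesis \<open>mass\<close>.\<close>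
    case 0
    then show ?thesis
      using mass space by simp
  next
    case (Suc j)
    then show ?thesis
      using res[of 0 j] \<delta>(1) by simp
  qed
  have int_pow: "integrable L (\<lambda>x. u x ^ k)" if "finite_measure L" "sets L = sets borel" for L k
    using int[OF that, of 0 k] \<delta>(1) by simp
  have "distr M borel u = distr N borel u"
  proof (rule distr_eq_of_polynomials[where K = "{0..1}"])
    show "AE x in M. u x \<in> {0..1}" "AE x in N. u x \<in> {0..1}"
      using u01 by (auto simp: less_imp_le)
    fix p :: "real \<Rightarrow> real"
    assume "real_polynomial_function p"
    then obtain a n where "p = (\<lambda>x. \<Sum>i\<le>n. a i * x ^ i)"
      by (auto simp: real_polynomial_function_iff_sum)
    then show "(\<integral>x. p (u x) \<partial>M) = (\<integral>x. p (u x) \<partial>N)"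
      using int_pow[OF fin(1) sets(1)] int_pow[OF fin(2) sets(2)]
      by (simp add: moments)
  qed (use fin sets in auto)
  \<comment> \<open>At \<open>v = u x\<close> the integrand is \<open>exp (- (l * s x))\<close>,
    since \<open>1 / u x = 1 + s x\<close>.\<close>
  then have "integral\<^sup>L (distr M borel u) (\<lambda>v. exp (l - l / v)) =
      integral\<^sup>L (distr N borel u) (\<lambda>v. exp (l - l / v))"
    by simp
  then have "(\<integral>x. exp (l - l / u x) \<partial>M) = (\<integral>x. exp (l - l / u x) \<partial>N)"
    by (simp add: integral_distr)
  then show ?thesis
    by (simp add: u_def algebra_simps)
qed

section \<open>Sums of exponentials\<close>

inductive_set exp_sums :: "'a::euclidean_space set \<Rightarrow> ('a \<Rightarrow> real) set" for C where
  monomial: "c \<in> C \<Longrightarrow> (\<lambda>x. k * exp (- (c \<bullet> x))) \<in> exp_sums C"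
| add: "f \<in> exp_sums C \<Longrightarrow> g \<in> exp_sums C \<Longrightarrow> (\<lambda>x. f x + g x) \<in> exp_sums C"

text \<open>Exponents add under multiplication. Together with \<open>0 \<in> C\<close>, which
  supplies the constants, this turns any polynomial in exponentials back into a sum of
  exponentials.\<close>

lemma exp_sums_mult:
  assumes C: "\<And>c d. c \<in> C \<Longrightarrow> d \<in> C \<Longrightarrow> c + d \<in> C"
    and "f \<in> exp_sums C" "g \<in> exp_sums C"
  shows "(\<lambda>x. f x * g x) \<in> exp_sums C"
  using assms(2)
proof (induction rule: exp_sums.induct)
  case (monomial c k)
  show ?case
    using assms(3)
  proof (induction rule: exp_sums.induct)
    case (monomial d j)
    then show ?case
      using exp_sums.monomial[OF C[OF \<open>c \<in> C\<close> monomial], of "k * j"]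
      by (simp add: inner_add_left exp_add[symmetric] algebra_simps exp_diff exp_minus field_simps)
  next
    case (add f g)
    then show ?case
      using exp_sums.add[OF add.IH] by (simp add: distrib_left)
  qed
next
  case (add f g)
  then show ?case
    using exp_sums.add[OF add.IH] by (simp add: distrib_right)
qed

lemma exp_sums_sum:
  assumes "0 \<in> C" "finite I" "\<And>i. i \<in> I \<Longrightarrow> f i \<in> exp_sums C"
  shows "(\<lambda>x. \<Sum>i\<in>I. f i x) \<in> exp_sums C"
  using assms(2,3)
proof (induction I rule: finite_induct)
  case empty
  then show ?case
    using exp_sums.monomial[OF assms(1), of 0] by simp
qed (auto intro: exp_sums.add)

text \<open>The extra coordinate \<open>exp (- (b \<bullet> x))\<close> of the map \<open>\<phi>\<close> makes it injective with an explicit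
  inverse, without choosing a basis inside the ball.\<close>

theorem Fantappie_unique:
  fixes M N :: "'a::euclidean_space measure"
  assumes fin: "finite_measure M" "finite_measure N"
    and sets [measurable_cong]: "sets M = sets borel" "sets N = sets borel"
    and X: "AE x in M. x \<in> X" "AE x in N. x \<in> X"
    and mass: "measure M UNIV = measure N UNIV"
    and e: "0 < e" and pos: "\<And>a x. a \<in> ball b e \<Longrightarrow> x \<in> X \<Longrightarrow> 0 \<le> a \<bullet> x"
    and eq: "\<And>a. a \<in> ball b e \<Longrightarrow> (\<integral>x. 1 / (a \<bullet> x + 1) \<partial>M) = (\<integral>x. 1 / (a \<bullet> x + 1) \<partial>N)"
  shows "M = N"
proof -
  interpret M: finite_measure M by fact
  interpret N: finite_measure N by fact
  have Laplace: "(\<integral>x. exp (- ((l *\<^sub>R a) \<bullet> x)) \<partial>M) = (\<integral>x. exp (- ((l *\<^sub>R a) \<bullet> x)) \<partial>N)"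
    if a: "a \<in> ball b e" for a l
  proof -
    \<comment> \<open>The one-dimensional result asks for \<open>s\<close> to be nonnegative
      everywhere; the truncation changes nothing on \<open>X\<close>.\<close>
    define s where "s = (\<lambda>x. max 0 (a \<bullet> x))"
    have [measurable]: "s \<in> borel_measurable borel"
      unfolding s_def by measurable
    have s_eq: "AE x in M. s x = a \<bullet> x" "AE x in N. s x = a \<bullet> x"
      using X pos[OF a] by (auto simp: s_def)
    \<comment> \<open>\<open>1 / (t + a \<bullet> x)\<close> is \<open>1 / t\<close> times the
      kernel at \<open>a / t\<close>, and \<open>a / t\<close> remains in the open ball for
      \<open>t\<close> near 1.\<close>
    have "((\<lambda>t. (1 / t) *\<^sub>R a) \<longlongrightarrow> (1 / 1) *\<^sub>R a) (at (1::real))"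
      by (intro tendsto_intros) auto
    then have "\<forall>\<^sub>F t in at (1::real). (1 / t) *\<^sub>R a \<in> ball b e"
      using a by (intro topological_tendstoD) auto
    then obtain d where d: "0 < d" "\<And>t. t \<noteq> 1 \<Longrightarrow> dist t 1 < d \<Longrightarrow> (1 / t) *\<^sub>R a \<in> ball b e"
      by (auto simp: eventually_at)
    have "(\<integral>x. 1 / (t + s x) \<partial>M) = (\<integral>x. 1 / (t + s x) \<partial>N)" if t: "\<bar>t - 1\<bar> < min d 1" for t
    proof -
      have t0: "t > 0"
        using t by linarith
      have ta: "(1 / t) *\<^sub>R a \<in> ball b e"
        using d(2)[of t] t a by (cases "t = 1") (auto simp: dist_real_def)
      have *: "1 / (t + a \<bullet> x) = (1 / t) * (1 / (((1 / t) *\<^sub>R a) \<bullet> x + 1))" for x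
      proof -
        have "t + a \<bullet> x = t * (((1 / t) *\<^sub>R a) \<bullet> x + 1)"
          using t0 by (simp add: distrib_left)
        then show ?thesis
          by simp
      qed
      have "(\<integral>x. 1 / (t + s x) \<partial>M) = (\<integral>x. (1 / t) * (1 / (((1 / t) *\<^sub>R a) \<bullet> x + 1)) \<partial>M)"
        unfolding *[symmetric] using s_eq(1) by (intro integral_cong_AE) auto
      also have "\<dots> = (\<integral>x. (1 / t) * (1 / (((1 / t) *\<^sub>R a) \<bullet> x + 1)) \<partial>N)"
        unfolding integral_mult_right_zero eq[OF ta] ..
      also have "\<dots> = (\<integral>x. 1 / (t + s x) \<partial>N)"
        unfolding *[symmetric] using s_eq(2) by (intro integral_cong_AE) auto
      finally show ?thesis .
    qed
    then have "(\<integral>x. exp (- (l * s x)) \<partial>M) = (\<integral>x. exp (- (l * s x)) \<partial>N)"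
      using d(1) by (intro Laplace_eq_of_Stieltjes_eq[OF fin sets _ _ mass, of s "min d 1"])
        (auto simp: s_def)
    moreover have "(\<integral>x. exp (- (l * s x)) \<partial>M) = (\<integral>x. exp (- ((l *\<^sub>R a) \<bullet> x)) \<partial>M)"
      using s_eq(1) by (intro integral_cong_AE) auto
    moreover have "(\<integral>x. exp (- (l * s x)) \<partial>N) = (\<integral>x. exp (- ((l *\<^sub>R a) \<bullet> x)) \<partial>N)"
      using s_eq(2) by (intro integral_cong_AE) auto
    ultimately show ?thesis
      by simp
  qed
  \<comment> \<open>The factor \<open>l = 0\<close> puts 0 into the cone; convexity of the ball
    makes the cone closed under addition.\<close>
  define C where "C = {l *\<^sub>R a | l a. 0 \<le> l \<and> a \<in> ball b e}"
  have CI: "l *\<^sub>R a \<in> C" if "0 \<le> l" "a \<in> ball b e" for l a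
    using that by (auto simp: C_def)
  have ball_C: "a \<in> C" if "a \<in> ball b e" for a
    using CI[of 1 a] that by simp
  have C_add: "c + c' \<in> C" if "c \<in> C" "c' \<in> C" for c c'
  proof -
    obtain l a l' a' where c: "c = l *\<^sub>R a" "c' = l' *\<^sub>R a'" "0 \<le> l" "0 \<le> l'"
      "a \<in> ball b e" "a' \<in> ball b e"
      using \<open>c \<in> C\<close> \<open>c' \<in> C\<close> by (auto simp: C_def)
    show ?thesis
    proof (cases "l + l' = 0")
      case True
      then have "l = 0" "l' = 0"
        using c(3,4) by auto
      then show ?thesis
        using that(1) c by simp
    next
      case False
      then have ll: "l + l' > 0"
        using c(3,4) by linarith
      have "(l / (l + l')) *\<^sub>R a + (l' / (l + l')) *\<^sub>R a' \<in> ball b e"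
        using c ll by (intro convexD[OF convex_ball]) (auto simp: add_divide_distrib[symmetric])
      from CI[OF less_imp_le[OF ll] this] show ?thesis
        using ll c by (simp add: scaleR_add_right)
    qed
  qed
  have C0: "0 \<in> C"
    using CI[of 0 b] e by simp
  have C_pos: "0 \<le> c \<bullet> x" if "c \<in> C" "x \<in> X" for c x
    using that pos by (auto simp: C_def)
  have exp_int: "integrable L (\<lambda>x. exp (- (c \<bullet> x)))"
    if "c \<in> C" "finite_measure L" "sets L = sets borel" "AE x in L. x \<in> X" for L c
  proof -
    interpret finite_measure L by fact
    note that(3) [measurable_cong]
    show ?thesis
      using that(4) C_pos[OF that(1)] by (intro integrable_const_bound[of _ 1]) auto
  qed
  have exp_sums_eq: "integrable M f \<and> integrable N f \<and> integral\<^sup>L M f = integral\<^sup>L N f"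
    if "f \<in> exp_sums C" for f
    using that
  proof (induction rule: exp_sums.induct)
    case (monomial c k)
    moreover have "(\<integral>x. exp (- (c \<bullet> x)) \<partial>M) = (\<integral>x. exp (- (c \<bullet> x)) \<partial>N)"
      using monomial Laplace unfolding C_def by blast
    ultimately show ?case
      using exp_int[OF monomial fin(1) sets(1) X(1)] exp_int[OF monomial fin(2) sets(2) X(2)] by simp
  next
    case (add f g)
    then show ?case
      by simp
  qed
  \<comment> \<open>The step \<open>e / 2\<close> stays inside the ball, and
    \<open>A i \<bullet> x - b \<bullet> x = (e / 2) * (x \<bullet> i)\<close> recovers each
    coordinate; \<open>\<psi>\<close> reads this difference off as one of logarithms.\<close>
  define A where "A = (\<lambda>i. b + (e / 2) *\<^sub>R i)"
  have A: "A i \<in> ball b e" if "i \<in> Basis" for i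
    using that e by (simp add: A_def dist_norm)
  have b: "b \<in> ball b e"
    using e by simp
  define \<phi> where "\<phi> = (\<lambda>x. (\<Sum>i\<in>Basis. exp (- (A i \<bullet> x)) *\<^sub>R i, exp (- (b \<bullet> x))))"
  define \<psi> where "\<psi> = (\<lambda>(y, z). \<Sum>i\<in>Basis. ((ln z - ln (y \<bullet> i)) / (e / 2)) *\<^sub>R (i::'a))"
  have [measurable]: "\<phi> \<in> borel_measurable borel"
    unfolding \<phi>_def
    by (intro borel_measurable_continuous_onI continuous_intros)
  have [measurable]: "\<psi> \<in> borel_measurable borel"
    unfolding \<psi>_def borel_prod[symmetric] by measurable
  have inverse: "\<psi> (\<phi> x) = x" for x
  proof -
    have "(ln (exp (- (b \<bullet> x))) - ln ((\<Sum>i\<in>Basis. exp (- (A i \<bullet> x)) *\<^sub>R i) \<bullet> i)) / (e / 2) = x \<bullet> i"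
      if "i \<in> Basis" for i
    proof -
      have "(\<Sum>j\<in>Basis. exp (- (A j \<bullet> x)) *\<^sub>R j) \<bullet> i = exp (- (A i \<bullet> x))"
        using that by simp
      then show ?thesis
        using e by (simp add: A_def inner_add_left inner_commute[of i x])
    qed
    then have "\<psi> (\<phi> x) = (\<Sum>i\<in>Basis. (x \<bullet> i) *\<^sub>R i)"
      unfolding \<psi>_def \<phi>_def split_conv by (intro sum.cong) auto
    then show ?thesis
      by (simp add: euclidean_representation)
  qed
  \<comment> \<open>On \<open>X\<close> no exponent is positive, so \<open>\<phi>\<close> maps the
    possibly unbounded \<open>X\<close> into a compact box.\<close>
  have K: "\<phi> x \<in> cbox 0 One \<times> cbox 0 1" if "x \<in> X" for x
    using pos[OF A that] pos[OF b that] by (auto simp: \<phi>_def mem_box)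
  have "distr M borel \<phi> = distr N borel \<phi>"
  proof (rule distr_eq_of_polynomials[where K = "cbox 0 One \<times> cbox 0 1"])
    show "compact (cbox 0 (One::'a) \<times> cbox 0 (1::real))"
      by (intro compact_Times compact_cbox)
    show "AE x in M. \<phi> x \<in> cbox 0 One \<times> cbox 0 1" "AE x in N. \<phi> x \<in> cbox 0 One \<times> cbox 0 1"
      using X K by (auto elim!: eventually_mono)
    fix p :: "'a \<times> real \<Rightarrow> real"
    assume "real_polynomial_function p"
    then have "(\<lambda>x. p (\<phi> x)) \<in> exp_sums C"
    proof (induction rule: real_polynomial_function.induct)
      case (linear f)
      interpret f: bounded_linear f by fact
      have "f (\<phi> x) = (\<Sum>i\<in>Basis. f (i, 0) * exp (- (A i \<bullet> x))) + f (0, 1) * exp (- (b \<bullet> x))" for x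
      proof -
        have "\<phi> x = (\<Sum>i\<in>Basis. exp (- (A i \<bullet> x)) *\<^sub>R (i, 0)) + exp (- (b \<bullet> x)) *\<^sub>R (0, 1)"
          by (simp add: \<phi>_def prod_eq_iff fst_sum snd_sum)
        then show ?thesis
          by (simp add: f.add f.sum f.scaleR mult.commute del: scaleR_Pair)
      qed
      then show ?case
        by (simp only:) (intro exp_sums.add exp_sums_sum exp_sums.monomial C0 ball_C A b; simp)
    next
      case (const c)
      then show ?case
        using exp_sums.monomial[OF C0, of c] by simp
    next
      case (add f g)
      then show ?case
        by (intro exp_sums.add)
    next
      case (mult f g)
      then show ?case
        by (intro exp_sums_mult C_add)
    qed
    then show "(\<integral>x. p (\<phi> x) \<partial>M) = (\<integral>x. p (\<phi> x) \<partial>N)"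
      using exp_sums_eq by blast
  qed (use fin sets in auto)
  then have "distr (distr M borel \<phi>) borel \<psi> = distr (distr N borel \<phi>) borel \<psi>"
    by simp
  then have "distr M borel (\<lambda>x. x) = distr N borel (\<lambda>x. x)"
    by (simp add: distr_distr comp_def inverse)
  moreover have "distr M borel (\<lambda>x. x) = M" "distr N borel (\<lambda>x. x) = N"
    using sets by (simp_all add: distr_id2)
  ultimately show ?thesis
    by simp
qed


subsection \<open>The extremal moment problem\<close>

lemma closed_dual_cone: "closed (dual_cone G)"
proof -
  have "dual_cone G = (\<Inter>x\<in>G. {\<eta>. 0 \<le> \<eta> \<bullet> x})"
    by (auto simp: dual_cone_def)
  then show ?thesis
    by (auto intro!: closed_INT closed_Collect_le continuous_intros)
qed

section \<open>Admissible measures\<close>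

lemma admissible_sets: "admissible X M \<Longrightarrow> sets M = sets borel"
  by (simp add: admissible_def)

lemma admissible_integrable: "admissible X M \<Longrightarrow> p \<in> polyfun \<Longrightarrow> integrable M p"
  by (simp add: admissible_def)

lemma admissible_space: "admissible X M \<Longrightarrow> space M = UNIV"
  using sets_eq_imp_space_eq[of M borel] by (simp add: admissible_def)

lemma admissible_finite_measure:
  assumes "admissible X M"
  shows "finite_measure M"
proof -
  have "integrable M (\<lambda>x. 1::real)"
    using admissible_integrable[OF assms polyfun.const] .
  then show ?thesis
    by (auto intro!: finite_measureI simp: integrable_iff_bounded less_top)
qed

lemma admissible_AE:
  assumes "admissible X M" "closed X"
  shows "AE x in M. x \<in> X"
proof (rule AE_I)
  show "emeasure M (UNIV - X) = 0"
    using assms by (simp add: admissible_def)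
  show "UNIV - X \<in> sets M"
    using assms by (simp add: admissible_def borel_open open_Diff)
qed auto

text \<open>Formed for arbitrary \<open>f\<close> rather than for the kernel alone, since
  Hahn--Banach needs a sublinear functional on the whole growth class.\<close>

definition poly_upper :: "'a::euclidean_space set \<Rightarrow> 'a measure \<Rightarrow> ('a \<Rightarrow> real) \<Rightarrow> real" where
  "poly_upper X M f = Inf ((\<lambda>q. integral\<^sup>L M q) ` {q\<in>polyfun. \<forall>x\<in>X. f x \<le> q x})"

lemma upper_val_eq: "upper_val X M a = poly_upper X M (\<lambda>x. 1 / (a \<bullet> x + 1))"
  by (simp add: upper_val_def poly_upper_def)

text \<open>Negation exchanges minorants and majorants. On the reals \<open>Inf\<close> is by
  definition the negated \<open>Sup\<close> of the negated set, so one functional serves both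
  values.\<close>

lemma lower_val_eq: "lower_val X M a = - poly_upper X M (\<lambda>x. - (1 / (a \<bullet> x + 1)))"
proof -
  let ?P = "{p\<in>polyfun. \<forall>x\<in>X. p x \<le> 1 / (a \<bullet> x + 1)}"
  let ?Q = "{q\<in>polyfun. \<forall>x\<in>X. - (1 / (a \<bullet> x + 1)) \<le> q x}"
  have "integral\<^sup>L M ` ?P = uminus ` integral\<^sup>L M ` ?Q"
  proof (intro equalityI subsetI)
    fix v
    assume "v \<in> integral\<^sup>L M ` ?P"
    then obtain p where p: "p \<in> ?P" "v = integral\<^sup>L M p"
      by blast
    then have "(\<lambda>x. - p x) \<in> ?Q"
      by (auto intro: polyfun_uminus)
    moreover have "v = - integral\<^sup>L M (\<lambda>x. - p x)"
      using p by simp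
    ultimately show "v \<in> uminus ` integral\<^sup>L M ` ?Q"
      by blast
  next
    fix v
    assume "v \<in> uminus ` integral\<^sup>L M ` ?Q"
    then obtain q where q: "q \<in> ?Q" "v = - integral\<^sup>L M q"
      by blast
    have "- q x \<le> 1 / (a \<bullet> x + 1)" if "x \<in> X" for x
    proof -
      have "- (1 / (a \<bullet> x + 1)) \<le> q x"
        using q(1) that by blast
      then show ?thesis
        by linarith
    qed
    then have "(\<lambda>x. - q x) \<in> ?P"
      using q(1) by (auto intro: polyfun_uminus)
    moreover have "v = integral\<^sup>L M (\<lambda>x. - q x)"
      using q by simp
    ultimately show "v \<in> integral\<^sup>L M ` ?P"
      by blast
  qed
  then show ?thesis
    unfolding lower_val_def poly_upper_def Inf_real_def by (simp add: image_image)
qed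

section \<open>The polynomial majorant value as a sublinear functional\<close>

locale admissible_measure =
  fixes X :: "'a::euclidean_space set" and M :: "'a measure"
  assumes closed_X: "closed X" and admissible: "admissible X M"
begin

lemma integral_poly_mono:
  assumes "p \<in> polyfun" "q \<in> polyfun" "\<And>x. x \<in> X \<Longrightarrow> p x \<le> q x"
  shows "integral\<^sup>L M p \<le> integral\<^sup>L M q"
  using admissible_AE[OF admissible closed_X] assms(3)
  by (intro integral_mono_AE admissible_integrable[OF admissible] assms) auto

text \<open>A polynomial \<open>p\<close> dominating the absolute value of \<open>f\<close> is a
  majorant, and \<open>- p\<close> lies below every majorant; so the infimum in
  \<open>poly_upper\<close> has its intended meaning.\<close>

lemma majorants:
  assumes "f \<in> poly_bounded X"
  shows "integral\<^sup>L M ` {q\<in>polyfun. \<forall>x\<in>X. f x \<le> q x} \<noteq> {}"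
    and "bdd_below (integral\<^sup>L M ` {q\<in>polyfun. \<forall>x\<in>X. f x \<le> q x})"
proof -
  obtain p where p: "p \<in> polyfun" "\<And>x. x \<in> X \<Longrightarrow> \<bar>f x\<bar> \<le> p x"
    using assms by (auto simp: poly_bounded_def)
  then have "f x \<le> p x" if "x \<in> X" for x
    using abs_le_D1 that by blast
  then show "integral\<^sup>L M ` {q\<in>polyfun. \<forall>x\<in>X. f x \<le> q x} \<noteq> {}"
    using p(1) by blast
  show "bdd_below (integral\<^sup>L M ` {q\<in>polyfun. \<forall>x\<in>X. f x \<le> q x})"
  proof (rule bdd_belowI2)
    fix q
    assume q: "q \<in> {q\<in>polyfun. \<forall>x\<in>X. f x \<le> q x}"
    show "integral\<^sup>L M (\<lambda>x. - p x) \<le> integral\<^sup>L M q"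
    proof (rule integral_poly_mono)
      show "- p x \<le> q x" if "x \<in> X" for x
        using q p(2)[OF that] that by (auto simp: abs_le_iff)
    qed (use q p polyfun_uminus in auto)
  qed
qed

lemma poly_upper_le:
  "f \<in> poly_bounded X \<Longrightarrow> q \<in> polyfun \<Longrightarrow> (\<And>x. x \<in> X \<Longrightarrow> f x \<le> q x) \<Longrightarrow>
    poly_upper X M f \<le> integral\<^sup>L M q"
  unfolding poly_upper_def by (intro cInf_lower majorants) auto

lemma poly_upper_ge:
  assumes "f \<in> poly_bounded X"
    and "\<And>q. q \<in> polyfun \<Longrightarrow> (\<And>x. x \<in> X \<Longrightarrow> f x \<le> q x) \<Longrightarrow> c \<le> integral\<^sup>L M q"
  shows "c \<le> poly_upper X M f"
  unfolding poly_upper_def using assms by (intro cInf_greatest majorants) auto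

lemma poly_upper_poly: "p \<in> polyfun \<Longrightarrow> poly_upper X M p = integral\<^sup>L M p"
  by (intro antisym poly_upper_le poly_upper_ge integral_poly_mono poly_bounded_polyfun) auto

lemma poly_upper_mono:
  assumes "f \<in> poly_bounded X" "g \<in> poly_bounded X" "\<And>x. x \<in> X \<Longrightarrow> f x \<le> g x"
  shows "poly_upper X M f \<le> poly_upper X M g"
  using assms by (intro poly_upper_ge poly_upper_le) (auto intro: order_trans)

lemma poly_upper_add:
  assumes f: "f \<in> poly_bounded X" and g: "g \<in> poly_bounded X"
  shows "poly_upper X M (\<lambda>x. f x + g x) \<le> poly_upper X M f + poly_upper X M g"
proof -
  have "poly_upper X M (\<lambda>x. f x + g x) - integral\<^sup>L M p \<le> poly_upper X M g"
    if p: "p \<in> polyfun" "\<And>x. x \<in> X \<Longrightarrow> f x \<le> p x" for p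
  proof (rule poly_upper_ge[OF g])
    fix q
    assume q: "q \<in> polyfun" "\<And>x. x \<in> X \<Longrightarrow> g x \<le> q x"
    have "poly_upper X M (\<lambda>x. f x + g x) \<le> integral\<^sup>L M (\<lambda>x. p x + q x)"
      using p q by (intro poly_upper_le poly_bounded_add f g polyfun.add) (auto intro: add_mono)
    also have "\<dots> = integral\<^sup>L M p + integral\<^sup>L M q"
      using p q admissible_integrable[OF admissible] by simp
    finally show "poly_upper X M (\<lambda>x. f x + g x) - integral\<^sup>L M p \<le> integral\<^sup>L M q"
      by simp
  qed
  then have "poly_upper X M (\<lambda>x. f x + g x) - poly_upper X M g \<le> poly_upper X M f"
    by (intro poly_upper_ge[OF f]) (simp add: algebra_simps)
  then show ?thesis
    by simp
qed

lemma sublinear_poly_upper: "sublinear_on (poly_bounded X) (poly_upper X M)"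
  unfolding sublinear_on_def
proof (intro conjI ballI allI impI poly_upper_add)
  fix f and c :: real
  assume f: "f \<in> poly_bounded X" and c: "0 \<le> c"
  show "poly_upper X M (\<lambda>x. c * f x) = c * poly_upper X M f"
  proof (cases "c = 0")
    case True
    then show ?thesis
      using poly_upper_poly[OF polyfun.const, of 0] by simp
  next
    case False
    with c have c: "c > 0"
      by simp
    \<comment> \<open>One inequality for all factors suffices: the reverse one is its instance with
      factor \<open>1 / c\<close> and function \<open>c * f\<close>.\<close>
    have le: "poly_upper X M (\<lambda>x. d * g x) \<le> d * poly_upper X M g"
      if d: "d > 0" and g: "g \<in> poly_bounded X" for d g
    proof -
      have "poly_upper X M (\<lambda>x. d * g x) / d \<le> poly_upper X M g"
      proof (rule poly_upper_ge[OF g])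
        fix q
        assume q: "q \<in> polyfun" "\<And>x. x \<in> X \<Longrightarrow> g x \<le> q x"
        have "poly_upper X M (\<lambda>x. d * g x) \<le> integral\<^sup>L M (\<lambda>x. d * q x)"
          using d q by (intro poly_upper_le poly_bounded_cmult g polyfun_cmult) auto
        then show "poly_upper X M (\<lambda>x. d * g x) / d \<le> integral\<^sup>L M q"
          using d by (simp add: field_simps)
      qed
      then show ?thesis
        using d by (simp add: field_simps)
    qed
    have "poly_upper X M (\<lambda>x. (1 / c) * (c * f x)) \<le> (1 / c) * poly_upper X M (\<lambda>x. c * f x)"
      using c by (intro le poly_bounded_cmult f) auto
    then have "c * poly_upper X M f \<le> poly_upper X M (\<lambda>x. c * f x)"
      using c by (simp add: field_simps)
    then show ?thesis
      using le[OF c f] by simp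
  qed
qed

text \<open>Domination by \<open>poly_upper\<close> carries all the information. If \<open>g\<close>
  is nonnegative on \<open>X\<close>, the zero polynomial majorizes \<open>- g\<close>, so
  \<open>L\<close> is positive; applied to \<open>p\<close> and \<open>- p\<close> it pins
  \<open>L p\<close> to the integral of \<open>p\<close>. Continuity of \<open>f\<close> lets the
  representing measure reproduce \<open>L f\<close>.\<close>

theorem poly_upper_attained:
  assumes f: "continuous_on UNIV f" and fE: "f \<in> poly_bounded X"
  obtains N where "admissible X N" "moment_equivalent M N" "integral\<^sup>L N f = poly_upper X M f"
proof -
  have E: "fun_subspace (poly_bounded X)"
    by (auto simp: fun_subspace_def poly_bounded_const intro: poly_bounded_add poly_bounded_cmult)
  obtain L where L: "linear_functional_on (poly_bounded X) L"
    "\<And>g. g \<in> poly_bounded X \<Longrightarrow> L g \<le> poly_upper X M g" "L f = poly_upper X M f"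
    using Hahn_Banach_attained[OF E sublinear_poly_upper fE] by blast
  have neg: "L (\<lambda>x. - g x) = - L g" if "g \<in> poly_bounded X" for g
  proof -
    have "L (\<lambda>x. - 1 * g x) = - 1 * L g"
      using L(1) that by (simp only: linear_functional_on_def)
    then show ?thesis
      by simp
  qed
  interpret L: positive_functional X L
  proof
    fix g
    assume g: "g \<in> poly_bounded X" "\<And>x. x \<in> X \<Longrightarrow> 0 \<le> g x"
    have "L (\<lambda>x. - g x) \<le> poly_upper X M (\<lambda>x. - g x)"
      by (intro L poly_bounded_uminus g)
    also have "\<dots> \<le> integral\<^sup>L M (\<lambda>x. 0)"
      using g by (intro poly_upper_le poly_bounded_uminus polyfun.const) auto
    finally show "0 \<le> L g"
      using neg[OF g(1)] by simp
  qed (rule closed_X L(1))+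
  have Lp: "L p = integral\<^sup>L M p" if p: "p \<in> polyfun" for p
    using L(2)[OF poly_bounded_polyfun[OF p]] L(2)[OF poly_bounded_polyfun[OF polyfun_uminus[OF p]]]
      poly_upper_poly[OF p] poly_upper_poly[OF polyfun_uminus[OF p]] neg[OF poly_bounded_polyfun[OF p]]
    by simp
  have rep: "integral\<^sup>L L.riesz_measure g = L g" if "continuous_on UNIV g" "g \<in> poly_bounded X" for g
    using L.riesz_representation[OF that] by (simp add: has_bochner_integral_iff)
  show thesis
  proof (rule that[OF L.admissible_riesz_measure])
    show "moment_equivalent M L.riesz_measure"
      unfolding moment_equivalent_def
      using rep Lp continuous_on_polyfun poly_bounded_polyfun by metis
    show "integral\<^sup>L L.riesz_measure f = poly_upper X M f"
      using rep[OF f fE] L(3) by simp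
  qed
qed

lemma integral_le_poly_upper:
  assumes N: "admissible X N" "moment_equivalent M N"
    and f: "f \<in> poly_bounded X" "integrable N f"
  shows "integral\<^sup>L N f \<le> poly_upper X M f"
proof (rule poly_upper_ge[OF f(1)])
  fix q
  assume q: "q \<in> polyfun" "\<And>x. x \<in> X \<Longrightarrow> f x \<le> q x"
  have "integral\<^sup>L N f \<le> integral\<^sup>L N q"
    using admissible_AE[OF N(1) closed_X] q(2)
    by (intro integral_mono_AE f(2) admissible_integrable[OF N(1) q(1)]) auto
  then show "integral\<^sup>L N f \<le> integral\<^sup>L M q"
    using N(2) q(1) by (simp add: moment_equivalent_def)
qed

end

section \<open>The kernel on a dual cone\<close>

locale cone_measure = admissible_measure "dual_cone G" M
  for G :: "'a::euclidean_space set" and M :: "'a measure"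
begin

lemma kernel:
  assumes a: "a \<in> G"
  shows "(\<lambda>x. 1 / (a \<bullet> x + 1)) \<in> poly_bounded (dual_cone G)"
    and "admissible (dual_cone G) N \<Longrightarrow> integrable N (\<lambda>x. 1 / (a \<bullet> x + 1))"
proof -
  have bound: "\<bar>1 / (a \<bullet> x + 1)\<bar> \<le> 1" if "x \<in> dual_cone G" for x
    using that a by (auto simp: dual_cone_def inner_commute)
  then show "(\<lambda>x. 1 / (a \<bullet> x + 1)) \<in> poly_bounded (dual_cone G)"
    by (rule poly_bounded_bounded)
  assume N: "admissible (dual_cone G) N"
  interpret finite_measure N
    using N by (rule admissible_finite_measure)
  note admissible_sets[OF N, measurable_cong]
  show "integrable N (\<lambda>x. 1 / (a \<bullet> x + 1))"
    using admissible_AE[OF N closed_X] bound by (intro integrable_const_bound[of _ 1]) auto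
qed

lemma integral_kernel_bounds:
  assumes a: "a \<in> G" and N: "admissible (dual_cone G) N" "moment_equivalent M N"
  shows "lower_val (dual_cone G) M a \<le> (\<integral>x. 1 / (a \<bullet> x + 1) \<partial>N)"
    and "(\<integral>x. 1 / (a \<bullet> x + 1) \<partial>N) \<le> upper_val (dual_cone G) M a"
proof -
  have "(\<integral>x. - (1 / (a \<bullet> x + 1)) \<partial>N) \<le> poly_upper (dual_cone G) M (\<lambda>x. - (1 / (a \<bullet> x + 1)))"
    by (intro integral_le_poly_upper N poly_bounded_uminus Bochner_Integration.integrable_minus kernel a)
  then show "lower_val (dual_cone G) M a \<le> (\<integral>x. 1 / (a \<bullet> x + 1) \<partial>N)"
    by (simp add: lower_val_eq)
  show "(\<integral>x. 1 / (a \<bullet> x + 1) \<partial>N) \<le> upper_val (dual_cone G) M a"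
    unfolding upper_val_eq by (intro integral_le_poly_upper N kernel a)
qed

lemma nonunique_of_gap:
  assumes a: "a \<in> G" and gap: "lower_val (dual_cone G) M a < upper_val (dual_cone G) M a"
  shows "\<exists>N. admissible (dual_cone G) N \<and> N \<noteq> M \<and> moment_equivalent M N"
proof -
  let ?X = "dual_cone G"
  \<comment> \<open>The truncation removes the pole of the kernel outside \<open>dual_cone G\<close>.\<close>
  define g where "g = (\<lambda>x. 1 / (max 0 (a \<bullet> x) + 1))"
  have g_eq: "g x = 1 / (a \<bullet> x + 1)" if "x \<in> ?X" for x
    using that a by (auto simp: dual_cone_def inner_commute g_def)
  have gc: "continuous_on UNIV g"
    unfolding g_def by (intro continuous_intros) (auto simp: add_nonneg_eq_0_iff)
  have gE: "g \<in> poly_bounded ?X"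
    using g_eq by (intro poly_bounded_mono[OF kernel(1)[OF a]]) simp
  have "poly_upper ?X M g = upper_val ?X M a"
    unfolding upper_val_eq
    by (intro antisym poly_upper_mono gE kernel a) (simp_all add: g_eq)
  then obtain N1 where N1: "admissible ?X N1" "moment_equivalent M N1"
    "integral\<^sup>L N1 g = upper_val ?X M a"
    using poly_upper_attained[OF gc gE] by metis
  have "poly_upper ?X M (\<lambda>x. - g x) = - lower_val ?X M a"
    unfolding lower_val_eq minus_minus
    by (intro antisym poly_upper_mono poly_bounded_uminus gE kernel a) (simp_all add: g_eq)
  moreover have "continuous_on UNIV (\<lambda>x. - g x)"
    by (intro continuous_intros gc)
  ultimately obtain N2 where N2: "admissible ?X N2" "moment_equivalent M N2"
    "integral\<^sup>L N2 (\<lambda>x. - g x) = - lower_val ?X M a"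
    using poly_upper_attained[OF _ poly_bounded_uminus[OF gE]] by metis
  have "N1 \<noteq> M \<or> N2 \<noteq> M"
    using N1(3) N2(3) gap by auto
  then show ?thesis
    using N1 N2 by blast
qed

text \<open>The kernel integrals against \<open>M\<close> and \<open>N\<close> both lie between the
  two values, so a kernel on which they differ forces a gap; \<open>Fantappie_unique\<close>
  supplies one in any ball inside \<open>G\<close>.\<close>

lemma gap_of_nonunique:
  assumes N: "admissible (dual_cone G) N" "N \<noteq> M" "moment_equivalent M N"
    and e: "0 < e" and ball: "ball b e \<subseteq> G"
  shows "\<exists>a\<in>ball b e. lower_val (dual_cone G) M a < upper_val (dual_cone G) M a"
proof -
  have mass: "measure M UNIV = measure N UNIV"
  proof -
    have "(\<integral>x. 1 \<partial>M) = (\<integral>x. (1::real) \<partial>N)"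
      using N(3) polyfun.const unfolding moment_equivalent_def by blast
    then show ?thesis
      by (simp add: admissible_space[OF admissible] admissible_space[OF N(1)])
  qed
  have "\<exists>a\<in>ball b e. (\<integral>x. 1 / (a \<bullet> x + 1) \<partial>M) \<noteq> (\<integral>x. 1 / (a \<bullet> x + 1) \<partial>N)"
  proof (rule ccontr)
    assume "\<not> ?thesis"
    moreover have "0 \<le> a \<bullet> x" if "a \<in> ball b e" "x \<in> dual_cone G" for a x
      using that ball by (auto simp: dual_cone_def inner_commute[of a x])
    ultimately have "M = N"
      by (intro Fantappie_unique[OF admissible_finite_measure admissible_finite_measure
            admissible_sets admissible_sets admissible_AE admissible_AE mass e])
         (auto intro: admissible N(1) closed_X)
    then show False
      using N(2) by simp
  qed
  then obtain a where a: "a \<in> ball b e"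
    "(\<integral>x. 1 / (a \<bullet> x + 1) \<partial>M) \<noteq> (\<integral>x. 1 / (a \<bullet> x + 1) \<partial>N)"
    by blast
  then have "a \<in> G"
    using ball by blast
  have "moment_equivalent M M"
    by (simp add: moment_equivalent_def)
  from integral_kernel_bounds[OF \<open>a \<in> G\<close> admissible this]
    integral_kernel_bounds[OF \<open>a \<in> G\<close> N(1,3)] a
  show ?thesis
    by force
qed

text \<open>The weight \<open>1 + x \<bullet> x\<close> replaces \<open>norm x\<close> because on a
  polynomial weight \<open>poly_upper\<close> is just the integral.\<close>

lemma kernel_Lipschitz:
  assumes "a \<in> G" "b \<in> G" "x \<in> dual_cone G"
  shows "\<bar>1 / (a \<bullet> x + 1) - 1 / (b \<bullet> x + 1)\<bar> \<le> dist a b * (1 + x \<bullet> x)"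
proof -
  have ab: "0 \<le> a \<bullet> x" "0 \<le> b \<bullet> x"
    using assms by (auto simp: dual_cone_def inner_commute)
  have "1 / (a \<bullet> x + 1) - 1 / (b \<bullet> x + 1) = ((b - a) \<bullet> x) / ((a \<bullet> x + 1) * (b \<bullet> x + 1))"
    using ab by (simp add: field_simps inner_diff_left)
  then have "\<bar>1 / (a \<bullet> x + 1) - 1 / (b \<bullet> x + 1)\<bar> = \<bar>(b - a) \<bullet> x\<bar> / ((a \<bullet> x + 1) * (b \<bullet> x + 1))"
    using ab by (simp add: abs_mult)
  also have "\<dots> \<le> \<bar>(b - a) \<bullet> x\<bar> / 1"
    using ab by (intro divide_left_mono) (auto intro: mult_ge1_I)
  also have "\<dots> \<le> dist a b * norm x"
    using Cauchy_Schwarz_ineq2[of "b - a" x] by (simp add: dist_norm norm_minus_commute)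
  also have "norm x \<le> 1 + x \<bullet> x"
    using abs_le_square[of "norm x"] by (simp add: dot_square_norm power2_eq_square)
  finally show ?thesis
    by (simp add: mult_left_mono)
qed

lemma open_gap_set: "open {a \<in> interior G. lower_val (dual_cone G) M a < upper_val (dual_cone G) M a}"
proof -
  let ?X = "dual_cone G" and ?k = "\<lambda>a x. 1 / (a \<bullet> x + 1)"
  define c where "c = integral\<^sup>L M (\<lambda>x. 1 + x \<bullet> x)"
  \<comment> \<open>The gap itself: the second summand is minus the lower value.\<close>
  define D where "D = (\<lambda>a. poly_upper ?X M (?k a) + poly_upper ?X M (\<lambda>x. - ?k a x))"
  have weight: "(\<lambda>x. d * (1 + x \<bullet> x)) \<in> polyfun" for d
    by (intro polyfun_cmult polyfun.add polyfun.const polyfun_inner_self)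
  \<comment> \<open>Adding \<open>d\<close> times the weight costs at most \<open>d * c\<close>.
    Used for the kernel and for its negative, whence the Lipschitz constant
    \<open>2 * c\<close>.\<close>
  have perturb: "poly_upper ?X M f \<le> poly_upper ?X M g + d * c"
    if "f \<in> poly_bounded ?X" "g \<in> poly_bounded ?X" "\<And>x. x \<in> ?X \<Longrightarrow> f x \<le> g x + d * (1 + x \<bullet> x)"
    for f g d
  proof -
    have "poly_upper ?X M f \<le> poly_upper ?X M (\<lambda>x. g x + d * (1 + x \<bullet> x))"
      by (intro poly_upper_mono poly_bounded_add poly_bounded_polyfun[OF weight] that)
    also have "\<dots> \<le> poly_upper ?X M g + poly_upper ?X M (\<lambda>x. d * (1 + x \<bullet> x))"
      by (intro poly_upper_add poly_bounded_polyfun[OF weight] that)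
    also have "poly_upper ?X M (\<lambda>x. d * (1 + x \<bullet> x)) = d * c"
      unfolding poly_upper_poly[OF weight] c_def by simp
    finally show ?thesis .
  qed
  have D_le: "D a \<le> D b + 2 * c * dist a b" if ab: "a \<in> G" "b \<in> G" for a b
  proof -
    have k: "?k a x \<le> ?k b x + dist a b * (1 + x \<bullet> x)" "- ?k a x \<le> - ?k b x + dist a b * (1 + x \<bullet> x)"
      if "x \<in> ?X" for x
      using kernel_Lipschitz[OF ab that] by linarith+
    show ?thesis
      using perturb[OF kernel(1)[OF ab(1)] kernel(1)[OF ab(2)] k(1)]
        perturb[OF poly_bounded_uminus[OF kernel(1)[OF ab(1)]] poly_bounded_uminus[OF kernel(1)[OF ab(2)]] k(2)]
      by (simp add: D_def algebra_simps)
  qed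
  have "(2 * c)-lipschitz_on (interior G) D"
  proof (rule lipschitz_onI)
    fix a b
    assume "a \<in> interior G" "b \<in> interior G"
    then have "a \<in> G" "b \<in> G"
      using interior_subset by blast+
    then show "dist (D a) (D b) \<le> 2 * c * dist a b"
      using D_le[of a b] D_le[of b a] by (simp add: dist_real_def abs_le_iff dist_commute)
  next
    show "0 \<le> 2 * c"
      by (simp add: c_def)
  qed
  then have "continuous_on (interior G) D"
    by (rule lipschitz_on_continuous_on)
  then have "open (interior G \<inter> D -` {0<..})"
    by (intro continuous_open_preimage) auto
  moreover have "interior G \<inter> D -` {0<..} =
      {a \<in> interior G. lower_val ?X M a < upper_val ?X M a}"
    by (auto simp: D_def upper_val_eq lower_val_eq)
  ultimately show ?thesis
    by simp
qed

end

section \<open>Equivalence, openness and density\<close>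

theorem theorem2p3:
  fixes G :: "'a::euclidean_space set" and M :: "'a measure"
  assumes "acute_cone G" and "convex G" and "solid G"
    and "admissible (dual_cone G) M"
  shows "((\<exists>N. admissible (dual_cone G) N \<and> N \<noteq> M \<and> moment_equivalent M N) \<longleftrightarrow>
           (\<exists>a\<in>interior G. lower_val (dual_cone G) M a < upper_val (dual_cone G) M a))
       \<and> ((\<exists>a\<in>interior G. lower_val (dual_cone G) M a < upper_val (dual_cone G) M a) \<longrightarrow>
           (let S = {a\<in>interior G. lower_val (dual_cone G) M a < upper_val (dual_cone G) M a}
            in open S \<and> interior G \<subseteq> closure S))"
proof -
  interpret cone_measure G M
    by unfold_locales (rule closed_dual_cone assms(4))+
  define S where "S = {a\<in>interior G. lower_val (dual_cone G) M a < upper_val (dual_cone G) M a}"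
  define nonunique where
    "nonunique \<longleftrightarrow> (\<exists>N. admissible (dual_cone G) N \<and> N \<noteq> M \<and> moment_equivalent M N)"
  \<comment> \<open>One local statement for two claims: at a single \<open>b\<close> it gives a gap,
    and with \<open>b\<close> and \<open>e\<close> arbitrary it gives density.\<close>
  have near: "\<exists>a\<in>S. dist a b < e" if nonunique "b \<in> interior G" "0 < e" for b e
  proof -
    obtain r where r: "r > 0" "ball b r \<subseteq> interior G"
      using \<open>b \<in> interior G\<close> open_contains_ball open_interior by blast
    define d where "d = min r e"
    have d: "0 < d" "ball b d \<subseteq> interior G" "ball b d \<subseteq> ball b e"
      using r \<open>0 < e\<close> by (auto simp: d_def)
    have "ball b d \<subseteq> G"
      using d(2) interior_subset by blast
    then obtain a where "a \<in> ball b d" "lower_val (dual_cone G) M a < upper_val (dual_cone G) M a"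
      using gap_of_nonunique[OF _ _ _ d(1)] \<open>nonunique\<close> unfolding nonunique_def by metis
    moreover have "dist a b < e" "a \<in> interior G"
      using subsetD[OF d(3) \<open>a \<in> ball b d\<close>] subsetD[OF d(2) \<open>a \<in> ball b d\<close>]
      by (simp_all add: dist_commute)
    ultimately show ?thesis
      by (auto simp: S_def)
  qed
  have iff: "nonunique \<longleftrightarrow> S \<noteq> {}"
  proof
    assume nonunique
    obtain b where "b \<in> interior G"
      using assms(3) by (auto simp: solid_def)
    then show "S \<noteq> {}"
      using near[OF \<open>nonunique\<close>, of b 1] by auto
  next
    assume "S \<noteq> {}"
    then obtain a where "a \<in> interior G" "lower_val (dual_cone G) M a < upper_val (dual_cone G) M a"
      by (auto simp: S_def)
    then show nonunique
      unfolding nonunique_def using nonunique_of_gap interior_subset by blast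
  qed
  moreover have "open S"
    unfolding S_def by (rule open_gap_set)
  moreover have "interior G \<subseteq> closure S" if "S \<noteq> {}"
    using near that iff by (auto simp: closure_approachable)
  moreover have "S \<noteq> {} \<longleftrightarrow> (\<exists>a\<in>interior G. lower_val (dual_cone G) M a < upper_val (dual_cone G) M a)"
    by (auto simp: S_def)
  ultimately show ?thesis
    unfolding Let_def S_def[symmetric] nonunique_def[symmetric] by blast
qed

end
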